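(* Let $b(t)=\sum_{n=-r}^{s} b_n t^n$ be a Laurent polynomial with $r,s$ positive integers and $b_{-r}\neq 0$, $b_s\neq 0$. Let $0<\rho_l\le\rho_h<\infty$ be such that $\Lambda(b)=\bigcap_{\rho\in[\rho_l,\rho_h]}\operatorname{sp} T(b_\rho)$. Then there exists a family of non-negative constants $C_\rho$, $\rho\in[\rho_l,\rho_h]$, such that the following hold. (i) For every partition $(\rho_j)_{j=0}^{n}$ of $[\rho_l,\rho_h]$, every $\Delta_v>0$ and every $(v_j)_{j=0}^{m}\in\mathcal{P}_{[0,2\pi]}(\Delta_v)$, $$\bigcap_{j=0}^{n}\bigl(\operatorname{sp} T(b_{\rho_j}^D)\bigr)_{C_{\rho_j}\Delta_v^2}\supset\Lambda(b).$$ (ii) $$\lim_{\Delta_\rho,\Delta_v\to 0}\Biggl[\ \sup_{\boldsymbol{\rho}\in\mathcal{P}(\Delta_\rho),\ \boldsymbol{v}\in\mathcal{P}(\Delta_v)} d_H\Biggl(\bigcap_{j=0}^{n}\bigl(\operatorname{sp} T(b_{\rho_j}^D)\bigr)_{C_{\rho_j}\Delta_v^2},\ \Lambda(b)\Biggr)\Biggr]=0,$$ where $\boldsymbol{\rho}=(\rho_j)_{j=0}^{n}$, $\mathcal{P}(\Delta_\rho)=\mathcal{P}_{[\rho_l,\rho_h]}(\Delta_\rho)$, $\boldsymbol{v}=(v_j)_{j=0}^{m}$, $\mathcal{P}(\Delta_v)=\mathcal{P}_{[0,2\pi]}(\Delta_v)$. In both parts $b_{\rho_j}^D$ is the polygon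 discretization of $b_{\rho_j}$ with respect to the partition $(v_j)_{j=0}^{m}$.
   Context: $\mathbb{T}$ is the unit circle in $\mathbb{C}$. For a continuous function (symbol) $a:\mathbb{T}\to\mathbb{C}$ with Fourier coefficients $(a_k)_{k\in\mathbb{Z}}$, $T(a)=(a_{j-k})_{j,k=0}^{\infty}$ is the Toeplitz operator on $\ell^2(\mathbb{N})$, a bounded operator, and $\operatorname{sp} T(a)$ is its spectrum. It is known (Gohberg) that $\operatorname{sp} T(a)=a(\mathbb{T})\cup\{\lambda\in\mathbb{C}\setminus a(\mathbb{T}):\operatorname{wind}(a-\lambda)\ne 0\}$, where $\operatorname{wind}(a-\lambda)$ is the winding number of the closed curve $v\mapsto a(e^{iv})$, $v\in[0,2\pi]$, around $\lambda$. For $\rho>0$, $b_\rho(t):=b(\rho t)$, $t\in\mathbb{T}$. The limit set: for $\lambda\in\mathbb{C}$ let $z_1(\lambda),\dots,z_{r+s}(\lambda)$ be the zeros, with multiplicity, of $z\mapsto z^r(b(z)-\lambda)$, ordered so that $|z_j(\lambda)|\le|z_{j+1}(\lambda)|$. Then $\Lambda(b):=\{\lambda\in\mathbb{C}: |z_r(\lambda)|=|z_{r+1}(\lambda)|\}$. It is a known theorem of Schmidt and Spitzer that $\Lambda(b)=\bigcap_{\rho\in(0,\infty)}\operatorname{sp} T(b_\rho)$. A partition of $[\alpha,\beta]$ is a finite sequence $\alpha=x_0<x_1<\dots<x_n=\beta$ (with $n$ arbitrary); its granularity is $\max_{0\le j\le n-1}(x_{j+1}-x_j)$. (If $\alpha=\beta$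 the only partition is the single point $x_0=\alpha$, with granularity $0$.) $\mathcal{P}_{[\alpha,\beta]}(\Delta)$ is the set of all partitions of $[\alpha,\beta]$ with granularity $\le\Delta$. Polygon discretization: given a partition $0=v_0<v_1<\dots<v_m=2\pi$ of $[0,2\pi]$ and $\rho>0$, $b_\rho^D:\mathbb{T}\to\mathbb{C}$ is the continuous symbol $$b_\rho^D(e^{iv}):=\frac{v-v_j}{v_{j+1}-v_j}\bigl(b_\rho(e^{iv_{j+1}})-b_\rho(e^{iv_j})\bigr)+b_\rho(e^{iv_j}),\qquad v\in[v_j,v_{j+1}).$$ The $\epsilon$-fattening of $X\subset\mathbb{C}$ is $(X)_\epsilon:=\bigcup_{x\in X}\{z\in\mathbb{C}:|z-x|\le\epsilon\}$. $d_H$ is the Hausdorff metric on the set $\mathcal{C}$ of non-empty closed bounded subsets of $\mathbb{C}$: $d_H(A,B):=\inf\{\epsilon: A\subset(B)_\epsilon,\ B\subset(A)_\epsilon\}$. *)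

theory Defs
  imports
    "HOL-Analysis.Analysis"
    "HOL-Computational_Algebra.Computational_Algebra"
begin

section \<open>Toeplitz operators on \<open>\<ell>\<^sup>2(\<nat>)\<close> and their spectra\<close>

definition ell2 :: "(nat \<Rightarrow> complex) set" where
  "ell2 = {x. summable (\<lambda>n. (cmod (x n))\<^sup>2)}"

definition ell2_norm :: "(nat \<Rightarrow> complex) \<Rightarrow> real" where
  "ell2_norm x = sqrt (\<Sum>n. (cmod (x n))\<^sup>2)"

text \<open>Operators on \<open>\<ell>\<^sup>2\<close> are represented by functions on sequences, of which only the
  restriction to \<^const>\<open>ell2\<close> matters.\<close>

definition bounded_op :: "((nat \<Rightarrow> complex) \<Rightarrow> (nat \<Rightarrow> complex)) \<Rightarrow> bool" where
  "bounded_op A \<longleftrightarrow>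
     (\<forall>x\<in>ell2. A x \<in> ell2) \<and>
     (\<forall>x\<in>ell2. \<forall>y\<in>ell2. A (\<lambda>n. x n + y n) = (\<lambda>n. A x n + A y n)) \<and>
     (\<forall>c. \<forall>x\<in>ell2. A (\<lambda>n. c * x n) = (\<lambda>n. c * A x n)) \<and>
     (\<exists>K. \<forall>x\<in>ell2. ell2_norm (A x) \<le> K * ell2_norm x)"

definition invertible_op :: "((nat \<Rightarrow> complex) \<Rightarrow> (nat \<Rightarrow> complex)) \<Rightarrow> bool" where
  "invertible_op A \<longleftrightarrow>
     bounded_op A \<and> (\<exists>B. bounded_op B \<and> (\<forall>x\<in>ell2. B (A x) = x \<and> A (B x) = x))"

definition op_spectrum :: "((nat \<Rightarrow> complex) \<Rightarrow> (nat \<Rightarrow> complex)) \<Rightarrow> complex set" where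
  "op_spectrum A = {\<mu>. \<not> invertible_op (\<lambda>x n. A x n - \<mu> * x n)}"

text \<open>A symbol is a function \<^typ>\<open>complex \<Rightarrow> complex\<close> of which only the values on the unit
  circle matter.\<close>

definition fourier_coeff :: "(complex \<Rightarrow> complex) \<Rightarrow> int \<Rightarrow> complex" where
  "fourier_coeff a k =
     integral {0..2*pi} (\<lambda>v. a (cis v) * cis (- (of_int k * v))) / of_real (2*pi)"

definition toeplitz :: "(complex \<Rightarrow> complex) \<Rightarrow> (nat \<Rightarrow> complex) \<Rightarrow> (nat \<Rightarrow> complex)" where
  "toeplitz a x = (\<lambda>j. \<Sum>k. fourier_coeff a (int j - int k) * x k)"

definition sp_toeplitz :: "(complex \<Rightarrow> complex) \<Rightarrow> complex set" where
  "sp_toeplitz a = op_spectrum (toeplitz a)"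


section \<open>Laurent polynomials and the limit set\<close>

definition laurent :: "nat \<Rightarrow> nat \<Rightarrow> (int \<Rightarrow> complex) \<Rightarrow> complex \<Rightarrow> complex" where
  "laurent r s b t = (\<Sum>n\<in>{- int r..int s}. b n * t powi n)"

definition dilate :: "real \<Rightarrow> (complex \<Rightarrow> complex) \<Rightarrow> complex \<Rightarrow> complex" where
  "dilate \<rho> a t = a (of_real \<rho> * t)"

text \<open>The polynomial \<open>z\<^sup>r (b(z) - \<mu>)\<close>; see \<open>poly_shifted_poly\<close> below.\<close>

definition shifted_poly :: "nat \<Rightarrow> nat \<Rightarrow> (int \<Rightarrow> complex) \<Rightarrow> complex \<Rightarrow> complex poly" where
  "shifted_poly r s b \<mu> = (\<Sum>k\<le>r + s. monom (b (int k - int r)) k) - monom \<mu> r"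

lemma poly_shifted_poly:
  assumes "z \<noteq> 0"
  shows "poly (shifted_poly r s b \<mu>) z = z ^ r * (laurent r s b z - \<mu>)"
proof -
  have "(\<Sum>n\<in>{- int r..int s}. z ^ r * (b n * z powi n))
      = (\<Sum>k\<le>r + s. b (int k - int r) * z ^ k)"
  proof (rule sum.reindex_bij_witness[of _ "\<lambda>k. int k - int r" "\<lambda>n. nat (n + int r)"])
    fix n assume "n \<in> {- int r..int s}"
    then have n: "n + int r \<ge> 0" by simp
    then have "z ^ nat (n + int r) = z powi (n + int r)"
      by (simp add: power_int_def)
    also have "\<dots> = z powi n * z ^ r"
      using assms by (simp add: power_int_add)
    finally show "b (int (nat (n + int r)) - int r) * z ^ nat (n + int r)
        = z ^ r * (b n * z powi n)"
      using n by simp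
  qed auto
  then show ?thesis
    by (simp add: shifted_poly_def laurent_def poly_sum poly_monom algebra_simps sum_distrib_left)
qed

text \<open>The list \<open>zs\<close> is 0-based, so \<open>z\<^sub>r(\<mu>)\<close> and \<open>z\<^sub>r\<^sub>+\<^sub>1(\<mu>)\<close> are \<open>zs ! (r - 1)\<close> and \<open>zs ! r\<close>.
  All lists \<open>zs\<close> as below have the same moduli, so the choice of ordering is immaterial.\<close>

definition limit_set :: "nat \<Rightarrow> nat \<Rightarrow> (int \<Rightarrow> complex) \<Rightarrow> complex set" where
  "limit_set r s b = {\<mu>. \<exists>zs. mset zs = proots (shifted_poly r s b \<mu>) \<and> sorted (map cmod zs) \<and>
                            cmod (zs ! (r - 1)) = cmod (zs ! r)}"


section \<open>Partitions and the polygon discretization\<close>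

definition is_partition :: "real \<Rightarrow> real \<Rightarrow> real list \<Rightarrow> bool" where
  "is_partition \<alpha> \<beta> xs \<longleftrightarrow> xs \<noteq> [] \<and> hd xs = \<alpha> \<and> last xs = \<beta> \<and> sorted_wrt (<) xs"

text \<open>The extra element 0 affects only the one-point partition, whose granularity is 0.\<close>

definition granularity :: "real list \<Rightarrow> real" where
  "granularity xs = Max (insert 0 {xs ! (j + 1) - xs ! j | j. j + 1 < length xs})"

definition partitions :: "real \<Rightarrow> real \<Rightarrow> real \<Rightarrow> real list set" where
  "partitions \<alpha> \<beta> \<Delta> = {xs. is_partition \<alpha> \<beta> xs \<and> granularity xs \<le> \<Delta>}"

text \<open>For \<open>t\<close> on the unit circle, \<open>Arg2pi t\<close> is the unique \<open>v \<in> [0, 2\<pi>)\<close> with \<open>t = e\<^sup>i\<^sup>v\<close>.\<close>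

definition polygon :: "real list \<Rightarrow> (complex \<Rightarrow> complex) \<Rightarrow> complex \<Rightarrow> complex" where
  "polygon vs a t =
     (let v = Arg2pi t;
          j = (THE j. j + 1 < length vs \<and> vs ! j \<le> v \<and> v < vs ! (j + 1))
      in of_real ((v - vs ! j) / (vs ! (j + 1) - vs ! j)) *
           (a (cis (vs ! (j + 1))) - a (cis (vs ! j))) + a (cis (vs ! j)))"

lemma polygon_cis:
  assumes part: "is_partition 0 (2 * pi) vs" and j: "j + 1 < length vs"
    and v: "vs ! j \<le> v" "v < vs ! (j + 1)"
  shows "polygon vs a (cis v) =
           of_real ((v - vs ! j) / (vs ! (j + 1) - vs ! j)) *
             (a (cis (vs ! (j + 1))) - a (cis (vs ! j))) + a (cis (vs ! j))"
proof -
  have less: "vs ! i < vs ! k" if "i < k" "k < length vs" for i k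
    using part that by (auto simp: is_partition_def sorted_wrt_iff_nth_less)
  have le: "vs ! i \<le> vs ! k" if "i \<le> k" "k < length vs" for i k
    using less[of i k] that by (cases "i = k") auto
  have ends: "vs ! 0 = 0" "vs ! (length vs - 1) = 2 * pi"
    using part by (auto simp: is_partition_def hd_conv_nth last_conv_nth)
  have last_le: "j + 1 \<le> length vs - 1" "length vs - 1 < length vs"
    using j by auto
  have "0 \<le> v"
    using le[of 0 j] j v(1) ends(1) by linarith
  have "v < 2 * pi"
    using le[OF last_le] v(2) ends(2) by linarith
  have arg: "Arg2pi (cis v) = v"
    by (rule Arg2pi_unique[of 1]) (use \<open>0 \<le> v\<close> \<open>v < 2 * pi\<close> in \<open>simp_all add: cis_conv_exp\<close>)
  have "i = j" if i: "i + 1 < length vs" "vs ! i \<le> v" "v < vs ! (i + 1)" for i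
  proof (cases i j rule: linorder_cases)
    case less
    then have "vs ! (i + 1) \<le> vs ! j" using le[of "i + 1" j] j by linarith
    then show ?thesis using i(3) v(1) by linarith
  next
    case greater
    then have "vs ! (j + 1) \<le> vs ! i" using le[of "j + 1" i] i(1) by linarith
    then show ?thesis using i(2) v(2) by linarith
  qed
  then have "(THE i. i + 1 < length vs \<and> vs ! i \<le> v \<and> v < vs ! (i + 1)) = j"
    by (intro the_equality) (use j v in blast)+
  then show ?thesis
    unfolding polygon_def Let_def arg by simp
qed


section \<open>Fattenings and the Hausdorff metric\<close>

definition fattening :: "real \<Rightarrow> complex set \<Rightarrow> complex set" where
  "fattening \<epsilon> X = (\<Union>x\<in>X. cball x \<epsilon>)"

text \<open>The infimum is taken in the extended reals, where that of the empty set is \<open>\<infinity>\<close>. For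
  non-empty bounded sets it is the infimum over a non-empty set of non-negative reals.\<close>

definition hausdorff_dist :: "complex set \<Rightarrow> complex set \<Rightarrow> ereal" where
  "hausdorff_dist A B =
     Inf (ereal ` {\<epsilon>. 0 \<le> \<epsilon> \<and> A \<subseteq> fattening \<epsilon> B \<and> B \<subseteq> fattening \<epsilon> A})"

end

theory Submission
  imports Defs
begin

text \<open>
  Two facts about Toeplitz operators with continuous symbols carry the proof. Write \<open>a\<^sub>\<rho>\<close> for the
  dilated Laurent polynomial and \<open>a\<^sub>\<rho>\<^sup>D\<close> for its polygon. Interpolating a smooth curve linearly gives
  \<open>|a\<^sub>\<rho>\<^sup>D - a\<^sub>\<rho>| \<le> C \<Delta>\<^sup>2\<close> on the circle, where \<open>C\<close> is twice a bound for the second derivative and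
  can be chosen uniformly on the compact range of radii (\<open>polygon_error_laurent\<close>, \<open>curvature_bound_bounded\<close>).

  The first fact gives the inclusion of the limit set: if \<open>|g - f| \<le> \<delta>\<close> on the circle, then the
  spectrum for \<open>f\<close> lies in the \<open>\<delta>\<close>-fattening of the spectrum for \<open>g\<close>
  (\<open>sp_toeplitz_subset_fattening\<close>). Classically this follows from Gohberg's description of the
  spectrum by winding numbers. The only consequences used are that \<open>f\<close> has no zero on the circle
  when \<open>T(f)\<close> is invertible (\<open>toeplitz_invertible_imp_nonzero\<close>) and that invertibility passes from
  \<open>T(f)\<close> to \<open>T(g)\<close> when \<open>|g - f| < |f|\<close> on the circle (\<open>toeplitz_invertible_rouche\<close>), and these
  have a direct proof without winding numbers. Approximation reduces to the case that \<open>f\<close> is a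
  Laurent polynomial \<open>q\<close>. Factoring \<open>q\<close> into linear factors shows that an invertible \<open>T(q)\<close> forces
  \<open>q\<close> to be a constant times a product of factors \<open>1 - w t\<close> and \<open>1 - w / t\<close> with \<open>|w| < 1\<close>, and
  multiplying a symbol by such factors changes its operator only by invertible operators on the
  left and on the right. So \<open>T(g)\<close> is invertible along with \<open>T(g / q)\<close>, and the latter is a
  Neumann series perturbation of the identity because \<open>|g / q - 1| < 1\<close>.

  The second fact is that invertibility is an open condition, since \<open>\<parallel>T(f)\<parallel> \<le> sup |f|\<close>
  (\<open>toeplitz_norm_bound\<close>, \<open>invertible_op_perturb\<close>). A point outside the limit set lies outside the
  spectrum for some \<open>a\<^sub>\<rho>\<close>; hence a neighbourhood of it stays outside the fattened spectra for all
  fine polygons of all radii near \<open>\<rho>\<close>, one of which occurs in every fine partition of the radii.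
  By compactness, for fine partitions the intersection lies in any given neighbourhood of the limit
  set (\<open>uniformly_in_fattening\<close>). As the intersection also contains the limit set, the Hausdorff
  distance tends to \<open>0\<close>.
\<close>

section \<open>The sequence space and perturbation of invertible operators\<close>

lemma ell2I:
  assumes "0 \<le> K" and "\<And>N. (\<Sum>n<N. (cmod (x n))\<^sup>2) \<le> K\<^sup>2"
  shows "x \<in> ell2" and "ell2_norm x \<le> K"
proof -
  have s: "summable (\<lambda>n. (cmod (x n))\<^sup>2)"
    by (rule summableI_nonneg_bounded[where x = "K\<^sup>2"]) (use assms in auto)
  then show "x \<in> ell2" by (simp add: ell2_def)
  have "(\<Sum>n. (cmod (x n))\<^sup>2) \<le> K\<^sup>2"
    by (rule suminf_le_const[OF s]) (rule assms)
  then show "ell2_norm x \<le> K"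
    unfolding ell2_norm_def by (rule real_le_lsqrt[rotated]) (use assms in auto)
qed

lemma ell2_norm_nonneg: "x \<in> ell2 \<Longrightarrow> 0 \<le> ell2_norm x"
  by (simp add: ell2_norm_def ell2_def suminf_nonneg)

lemma ell2_norm_square:
  assumes "x \<in> ell2"
  shows "(ell2_norm x)\<^sup>2 = (\<Sum>n. (cmod (x n))\<^sup>2)"
  using assms by (auto simp: ell2_norm_def ell2_def suminf_nonneg)

lemma ell2_sum_le:
  assumes "x \<in> ell2" "finite F"
  shows "(\<Sum>n\<in>F. (cmod (x n))\<^sup>2) \<le> (ell2_norm x)\<^sup>2"
  unfolding ell2_norm_square[OF assms(1)]
  by (rule sum_le_suminf) (use assms in \<open>auto simp: ell2_def\<close>)

lemma ell2_component_le:
  assumes "x \<in> ell2"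
  shows "cmod (x n) \<le> ell2_norm x"
  using ell2_sum_le[OF assms, of "{n}"] ell2_norm_nonneg[OF assms]
  by (simp add: power2_le_iff_abs_le)

lemma ell2_norm_eq_0D: "x \<in> ell2 \<Longrightarrow> ell2_norm x \<le> 0 \<Longrightarrow> x = (\<lambda>n. 0)"
  using ell2_component_le[of x] by (metis norm_le_zero_iff order_trans)

lemma ell2_zero: "(\<lambda>n. 0) \<in> ell2" "ell2_norm (\<lambda>n. 0) = 0"
  by (auto simp: ell2_def ell2_norm_def)

lemma ell2_add:
  assumes "x \<in> ell2" "y \<in> ell2"
  shows "(\<lambda>n. x n + y n) \<in> ell2" and "ell2_norm (\<lambda>n. x n + y n) \<le> ell2_norm x + ell2_norm y"
proof -
  have "(\<Sum>n<N. (cmod (x n + y n))\<^sup>2) \<le> (ell2_norm x + ell2_norm y)\<^sup>2" for N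
  proof -
    have part: "L2_set (\<lambda>n. cmod (z n)) {..<N} \<le> ell2_norm z" if "z \<in> ell2" for z
      using ell2_sum_le[OF that, of "{..<N}"] ell2_norm_nonneg[OF that]
      unfolding L2_set_def by (simp add: real_le_lsqrt)
    have "L2_set (\<lambda>n. cmod (x n + y n)) {..<N} \<le> L2_set (\<lambda>n. cmod (x n) + cmod (y n)) {..<N}"
      by (rule L2_set_mono) (auto simp: norm_triangle_ineq)
    also have "\<dots> \<le> L2_set (\<lambda>n. cmod (x n)) {..<N} + L2_set (\<lambda>n. cmod (y n)) {..<N}"
      by (rule L2_set_triangle_ineq)
    also have "\<dots> \<le> ell2_norm x + ell2_norm y"
      by (intro add_mono part assms)
    finally show ?thesis
      unfolding L2_set_def by (rule sqrt_le_D)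
  qed
  from ell2I[OF _ this] show "(\<lambda>n. x n + y n) \<in> ell2"
    "ell2_norm (\<lambda>n. x n + y n) \<le> ell2_norm x + ell2_norm y"
    by (simp_all add: ell2_norm_nonneg assms)
qed

lemma ell2_scale:
  assumes "x \<in> ell2"
  shows "(\<lambda>n. c * x n) \<in> ell2" and "ell2_norm (\<lambda>n. c * x n) = cmod c * ell2_norm x"
  using assms
  by (auto simp: ell2_def ell2_norm_def norm_mult power_mult_distrib summable_mult suminf_mult
      real_sqrt_mult)

lemma ell2_diff:
  assumes "x \<in> ell2" "y \<in> ell2"
  shows "(\<lambda>n. x n - y n) \<in> ell2" and "ell2_norm (\<lambda>n. x n - y n) \<le> ell2_norm x + ell2_norm y"
  using ell2_add[OF assms(1) ell2_scale(1)[OF assms(2), of "-1"]] ell2_scale(2)[OF assms(2), of "-1"]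
  by simp_all

lemma ell2_norm_minus_commute: "ell2_norm (\<lambda>n. x n - y n) = ell2_norm (\<lambda>n. y n - x n)"
  by (simp add: ell2_norm_def norm_minus_commute)

text \<open>Completeness, in the form needed for Neumann series: increments decaying geometrically force
  convergence. The limit is taken componentwise; the norm estimate passes to it because it
  only involves finitely many components at a time.\<close>

lemma ell2_geometric_convergent:
  assumes X: "\<And>m. X m \<in> ell2" and \<theta>: "0 \<le> \<theta>" "\<theta> < 1" and c: "0 \<le> c"
    and step: "\<And>m. ell2_norm (\<lambda>n. X (Suc m) n - X m n) \<le> c * \<theta> ^ m"
  obtains x where "x \<in> ell2" "\<And>m. ell2_norm (\<lambda>n. x n - X m n) \<le> c / (1 - \<theta>) * \<theta> ^ m"
proof -
  have "convergent (\<lambda>m. X m n)" for n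
  proof -
    have "summable (\<lambda>m. X (Suc m) n - X m n)"
    proof (rule summable_comparison_test')
      show "summable (\<lambda>m. c * \<theta> ^ m)" using \<theta> by (intro summable_mult summable_geometric) auto
      show "norm (X (Suc m) n - X m n) \<le> c * \<theta> ^ m" for m
        using ell2_component_le[OF ell2_diff(1)[OF X[of "Suc m"] X[of m]], of n] step[of m] by (simp add: order_trans)
    qed
    then obtain l where "(\<lambda>N. \<Sum>m<N. X (Suc m) n - X m n) \<longlonglongrightarrow> l"
      by (auto simp: summable_def sums_def)
    then have "(\<lambda>N. X N n - X 0 n) \<longlonglongrightarrow> l"
      by (simp add: sum_lessThan_telescope[of "\<lambda>m. X m n"])
    from tendsto_add[OF this tendsto_const[of "X 0 n"]] show ?thesis by (auto simp: convergent_def)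
  qed
  then obtain x where x: "\<And>n. (\<lambda>m. X m n) \<longlonglongrightarrow> x n"
    unfolding convergent_def by metis
  have far: "ell2_norm (\<lambda>n. X (m + p) n - X m n) \<le> c / (1 - \<theta>) * \<theta> ^ m * (1 - \<theta> ^ p)" for m p
  proof (induction p)
    case 0
    then show ?case by (simp add: ell2_zero)
  next
    case (Suc p)
    have "ell2_norm (\<lambda>n. X (m + Suc p) n - X m n)
        \<le> ell2_norm (\<lambda>n. X (Suc (m + p)) n - X (m + p) n) + ell2_norm (\<lambda>n. X (m + p) n - X m n)"
      using ell2_add(2)[OF ell2_diff(1)[OF X X] ell2_diff(1)[OF X X], of "Suc (m + p)" "m + p" "m + p" m]
      by simp
    also have "\<dots> \<le> c * \<theta> ^ (m + p) + c / (1 - \<theta>) * \<theta> ^ m * (1 - \<theta> ^ p)"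
      by (intro add_mono step Suc.IH)
    also have "\<dots> = c / (1 - \<theta>) * \<theta> ^ m * (1 - \<theta> ^ Suc p)"
      using \<theta> by (simp add: field_simps power_add)
    finally show ?case .
  qed
  have lim: "(\<lambda>n. x n - X m n) \<in> ell2" "ell2_norm (\<lambda>n. x n - X m n) \<le> c / (1 - \<theta>) * \<theta> ^ m" for m
  proof -
    let ?K = "c / (1 - \<theta>) * \<theta> ^ m"
    have K: "0 \<le> ?K" using \<theta> c by simp
    have "(\<Sum>n<N. (cmod (x n - X m n))\<^sup>2) \<le> ?K\<^sup>2" for N
    proof (rule LIMSEQ_le_const2)
      have "(\<lambda>p. X (p + m) n) \<longlonglongrightarrow> x n" for n
        using x by (rule LIMSEQ_ignore_initial_segment)
      then show "(\<lambda>p. \<Sum>n<N. (cmod (X (m + p) n - X m n))\<^sup>2) \<longlonglongrightarrow> (\<Sum>n<N. (cmod (x n - X m n))\<^sup>2)"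
        by (intro tendsto_intros) (simp add: add.commute)
      have "(\<Sum>n<N. (cmod (X (m + p) n - X m n))\<^sup>2) \<le> ?K\<^sup>2" for p
      proof -
        have "ell2_norm (\<lambda>n. X (m + p) n - X m n) \<le> ?K"
          using far[of m p] mult_left_mono[OF _ K, of "1 - \<theta> ^ p" 1] \<theta> by simp
        then show ?thesis
          using ell2_sum_le[OF ell2_diff(1)[OF X X], of "{..<N}" "m + p" m]
            power_mono[OF _ ell2_norm_nonneg[OF ell2_diff(1)[OF X X]]]
          by (meson finite_lessThan order_trans)
      qed
      then show "\<exists>M. \<forall>p\<ge>M. (\<Sum>n<N. (cmod (X (m + p) n - X m n))\<^sup>2) \<le> ?K\<^sup>2" by blast
    qed
    from ell2I[OF K this] show "(\<lambda>n. x n - X m n) \<in> ell2"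
      "ell2_norm (\<lambda>n. x n - X m n) \<le> ?K" by simp_all
  qed
  show thesis
  proof (rule that)
    show "x \<in> ell2" using ell2_add(1)[OF lim(1) X, of 0 0] by simp
  qed (rule lim(2))
qed

lemma bounded_opD:
  assumes "bounded_op A"
  shows "x \<in> ell2 \<Longrightarrow> A x \<in> ell2"
    and "x \<in> ell2 \<Longrightarrow> y \<in> ell2 \<Longrightarrow> A (\<lambda>n. x n + y n) = (\<lambda>n. A x n + A y n)"
    and "x \<in> ell2 \<Longrightarrow> A (\<lambda>n. c * x n) = (\<lambda>n. c * A x n)"
  using assms unfolding bounded_op_def by blast+

lemma bounded_op_diff:
  assumes "bounded_op A" "x \<in> ell2" "y \<in> ell2"
  shows "A (\<lambda>n. x n - y n) = (\<lambda>n. A x n - A y n)"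
  using bounded_opD(2)[OF assms(1,2) ell2_scale(1)[OF assms(3), of "-1"]]
    bounded_opD(3)[OF assms(1,3), of "-1"] by simp

lemma bounded_op_bound:
  assumes "bounded_op A"
  obtains K where "0 < K" "\<And>x. x \<in> ell2 \<Longrightarrow> ell2_norm (A x) \<le> K * ell2_norm x"
proof -
  obtain K where K: "\<And>x. x \<in> ell2 \<Longrightarrow> ell2_norm (A x) \<le> K * ell2_norm x"
    using assms unfolding bounded_op_def by blast
  show thesis
  proof
    show "0 < max K 1" by simp
    show "ell2_norm (A x) \<le> max K 1 * ell2_norm x" if "x \<in> ell2" for x
      using K[OF that] mult_right_mono[OF max.cobounded1 ell2_norm_nonneg[OF that], of K 1] by linarith
  qed
qed

lemma bounded_op_cong:
  assumes "bounded_op A" "\<And>x. x \<in> ell2 \<Longrightarrow> A' x = A x"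
  shows "bounded_op A'"
  using assms unfolding bounded_op_def by (simp add: ell2_add ell2_scale)

lemma invertible_op_cong:
  assumes "\<And>x. x \<in> ell2 \<Longrightarrow> A' x = A x"
  shows "invertible_op A' \<longleftrightarrow> invertible_op A"
proof -
  have "invertible_op A2" if "invertible_op A1" "\<And>x. x \<in> ell2 \<Longrightarrow> A2 x = A1 x" for A1 A2
  proof -
    obtain B where B: "bounded_op A1" "bounded_op B" "\<And>x. x \<in> ell2 \<Longrightarrow> B (A1 x) = x \<and> A1 (B x) = x"
      using \<open>invertible_op A1\<close> unfolding invertible_op_def by blast
    then show ?thesis
      unfolding invertible_op_def
      using bounded_op_cong[OF B(1) that(2)] that(2) bounded_opD(1)[OF B(2)] by metis
  qed
  then show ?thesis using assms by metis
qed

lemma invertible_opE: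
  assumes "invertible_op A"
  obtains B where "bounded_op A" "bounded_op B" "\<And>x. x \<in> ell2 \<Longrightarrow> B (A x) = x"
    "\<And>x. x \<in> ell2 \<Longrightarrow> A (B x) = x"
  using assms unfolding invertible_op_def by blast

lemma bounded_op_compose:
  assumes A: "bounded_op A" and B: "bounded_op B"
  shows "bounded_op (\<lambda>x. A (B x))"
proof -
  obtain KA where KA: "0 < KA" "\<And>x. x \<in> ell2 \<Longrightarrow> ell2_norm (A x) \<le> KA * ell2_norm x"
    using bounded_op_bound[OF A] by metis
  obtain KB where KB: "0 < KB" "\<And>x. x \<in> ell2 \<Longrightarrow> ell2_norm (B x) \<le> KB * ell2_norm x"
    using bounded_op_bound[OF B] by metis
  have "ell2_norm (A (B x)) \<le> (KA * KB) * ell2_norm x" if "x \<in> ell2" for x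
    using KA(2)[OF bounded_opD(1)[OF B that]] mult_left_mono[OF KB(2)[OF that] less_imp_le[OF KA(1)]]
    by (simp only: mult.assoc)
  then show ?thesis
    unfolding bounded_op_def using A B by (auto simp: bounded_opD)
qed

lemma invertible_op_compose:
  assumes "invertible_op A" "invertible_op B"
  shows "invertible_op (\<lambda>x. A (B x))"
proof -
  obtain A' where A: "bounded_op A" "bounded_op A'" "\<And>x. x \<in> ell2 \<Longrightarrow> A' (A x) = x"
    "\<And>x. x \<in> ell2 \<Longrightarrow> A (A' x) = x" using invertible_opE[OF assms(1)] by metis
  obtain B' where B: "bounded_op B" "bounded_op B'" "\<And>x. x \<in> ell2 \<Longrightarrow> B' (B x) = x"
    "\<And>x. x \<in> ell2 \<Longrightarrow> B (B' x) = x" using invertible_opE[OF assms(2)] by metis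
  show ?thesis
    unfolding invertible_op_def
  proof (intro conjI exI ballI)
    show "bounded_op (\<lambda>x. A (B x))" "bounded_op (\<lambda>x. B' (A' x))"
      using A B by (auto intro: bounded_op_compose)
  qed (use A B in \<open>auto simp: bounded_opD(1)\<close>)
qed

lemma invertible_op_compose_iff:
  assumes A: "bounded_op A" and B: "invertible_op B"
  shows "invertible_op (\<lambda>x. A (B x)) \<longleftrightarrow> invertible_op A"
    and "invertible_op (\<lambda>x. B (A x)) \<longleftrightarrow> invertible_op A"
proof -
  obtain B' where B': "bounded_op B" "bounded_op B'" "\<And>x. x \<in> ell2 \<Longrightarrow> B' (B x) = x"
    "\<And>x. x \<in> ell2 \<Longrightarrow> B (B' x) = x" using invertible_opE[OF B] by metis
  have inv: "invertible_op B'" unfolding invertible_op_def using B' by auto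
  show "invertible_op (\<lambda>x. A (B x)) \<longleftrightarrow> invertible_op A"
  proof
    assume "invertible_op (\<lambda>x. A (B x))"
    from invertible_op_compose[OF this inv] show "invertible_op A"
      by (subst invertible_op_cong[of A "\<lambda>x. A (B (B' x))"]) (use B' in auto)
  qed (rule invertible_op_compose[OF _ B])
  show "invertible_op (\<lambda>x. B (A x)) \<longleftrightarrow> invertible_op A"
  proof
    assume "invertible_op (\<lambda>x. B (A x))"
    from invertible_op_compose[OF inv this] show "invertible_op A"
      by (subst invertible_op_cong[of A "\<lambda>x. B' (B (A x))"]) (use B' bounded_opD(1)[OF A] in auto)
  qed (rule invertible_op_compose[OF B])
qed

lemma invertible_op_if_bounded_below_surj:
  assumes A: "bounded_op A" and c: "0 < c"
    and below: "\<And>x. x \<in> ell2 \<Longrightarrow> c * ell2_norm x \<le> ell2_norm (A x)"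
    and surj: "\<And>y. y \<in> ell2 \<Longrightarrow> \<exists>x\<in>ell2. A x = y"
  shows "invertible_op A"
proof -
  obtain B where B: "\<And>y. y \<in> ell2 \<Longrightarrow> B y \<in> ell2" "\<And>y. y \<in> ell2 \<Longrightarrow> A (B y) = y"
    using surj by metis
  have inj: "x = y" if "x \<in> ell2" "y \<in> ell2" "A x = A y" for x y
  proof -
    have "c * ell2_norm (\<lambda>n. x n - y n) \<le> 0"
      using below[OF ell2_diff(1)[OF that(1,2)]] that ell2_zero(2)
      by (simp add: bounded_op_diff[OF A that(1,2)])
    then have "ell2_norm (\<lambda>n. x n - y n) \<le> 0"
      using c by (simp add: mult_le_0_iff)
    from ell2_norm_eq_0D[OF ell2_diff(1)[OF that(1,2)] this] show ?thesis
      by (metis eq_iff_diff_eq_0 ext)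
  qed
  have "bounded_op B"
    unfolding bounded_op_def
  proof (intro conjI ballI allI exI)
    fix x y assume xy: "x \<in> ell2" "y \<in> ell2"
    then show "B x \<in> ell2" by (simp add: B)
    show "B (\<lambda>n. x n + y n) = (\<lambda>n. B x n + B y n)"
      by (rule inj) (use xy B A in \<open>auto simp: ell2_add bounded_opD\<close>)
  next
    fix k x assume x: "x \<in> ell2"
    show "B (\<lambda>n. k * x n) = (\<lambda>n. k * B x n)"
      by (rule inj) (use x B A in \<open>auto simp: ell2_scale bounded_opD\<close>)
    show "ell2_norm (B x) \<le> inverse c * ell2_norm x"
      using below[OF B(1)[OF x]] B(2)[OF x] c by (simp add: field_simps)
  qed
  moreover have "B (A x) = x" if "x \<in> ell2" for x
    by (rule inj) (use that B bounded_opD(1)[OF A] in auto)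
  ultimately show ?thesis
    unfolding invertible_op_def using A B by auto
qed

text \<open>The set of invertible operators is open. The equation \<open>A' x = y\<close> is solved by the iteration
  \<open>x \<leftarrow> A\<^sup>-\<^sup>1 (y - (A' - A) x)\<close>.\<close>

lemma invertible_op_perturb:
  assumes A: "bounded_op A" and B: "bounded_op B"
    and BA: "\<And>x. x \<in> ell2 \<Longrightarrow> B (A x) = x" and AB: "\<And>x. x \<in> ell2 \<Longrightarrow> A (B x) = x"
    and K: "0 < K" "\<And>x. x \<in> ell2 \<Longrightarrow> ell2_norm (B x) \<le> K * ell2_norm x"
    and A': "bounded_op A'"
    and \<epsilon>: "0 \<le> \<epsilon>" "\<And>x. x \<in> ell2 \<Longrightarrow> ell2_norm (\<lambda>n. A' x n - A x n) \<le> \<epsilon> * ell2_norm x"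
    and small: "K * \<epsilon> < 1"
  shows "invertible_op A'"
proof (rule invertible_op_if_bounded_below_surj[OF A'])
  have A2: "A x \<in> ell2" "A' x \<in> ell2" "B x \<in> ell2" if "x \<in> ell2" for x
    using that A A' B by (auto simp: bounded_opD)
  show "0 < 1 / K - \<epsilon>" using small K(1) by (simp add: field_simps)
  show "(1 / K - \<epsilon>) * ell2_norm x \<le> ell2_norm (A' x)" if x: "x \<in> ell2" for x
  proof -
    have "ell2_norm x \<le> K * ell2_norm (A x)"
      using K(2)[OF A2(1)[OF x]] BA[OF x] by simp
    then have "ell2_norm x / K \<le> ell2_norm (A x)"
      using K(1) by (simp add: field_simps)
    also have "ell2_norm (A x) \<le> ell2_norm (A' x) + ell2_norm (\<lambda>n. A' x n - A x n)"
      using ell2_diff(2)[OF A2(2)[OF x] ell2_diff(1)[OF A2(2)[OF x] A2(1)[OF x]]] by simp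
    finally show ?thesis using \<epsilon>(2)[OF x] by (simp add: algebra_simps)
  qed
  fix y assume y: "y \<in> ell2"
  define E where "E x = (\<lambda>n. A' x n - A x n)" for x
  have E: "E x \<in> ell2" "ell2_norm (E x) \<le> \<epsilon> * ell2_norm x" if "x \<in> ell2" for x
    using that A2 \<epsilon> by (auto simp: E_def ell2_diff)
  have E_diff: "E (\<lambda>n. x n - z n) = (\<lambda>n. E x n - E z n)" if "x \<in> ell2" "z \<in> ell2" for x z
    unfolding E_def bounded_op_diff[OF A that] bounded_op_diff[OF A' that] by (simp add: algebra_simps)
  define X where "X = rec_nat (\<lambda>n. 0) (\<lambda>_ x. B (\<lambda>n. y n - E x n))"
  have X_Suc: "X (Suc m) = B (\<lambda>n. y n - E (X m) n)" for m
    by (simp add: X_def)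
  have X: "X m \<in> ell2" for m
  proof (induction m)
    case 0
    then show ?case by (simp add: X_def ell2_zero)
  next
    case (Suc m)
    then show ?case unfolding X_Suc by (intro A2 ell2_diff y E)
  qed
  define \<theta> where "\<theta> = K * \<epsilon>"
  have \<theta>: "0 \<le> \<theta>" "\<theta> < 1" using K \<epsilon> small by (auto simp: \<theta>_def)
  define c where "c = ell2_norm (\<lambda>n. X (Suc 0) n - X 0 n)"
  have step: "ell2_norm (\<lambda>n. X (Suc m) n - X m n) \<le> c * \<theta> ^ m" for m
  proof (induction m)
    case 0
    then show ?case by (simp add: c_def)
  next
    case (Suc m)
    have yE: "(\<lambda>n. y n - E (X m) n) \<in> ell2" for m by (intro ell2_diff y E X)
    have "(\<lambda>n. X (Suc (Suc m)) n - X (Suc m) n)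
        = B (\<lambda>n. (y n - E (X (Suc m)) n) - (y n - E (X m) n))"
      unfolding X_Suc[of "Suc m"] bounded_op_diff[OF B yE yE] by (simp add: X_Suc[of m])
    also have "\<dots> = B (E (\<lambda>n. X m n - X (Suc m) n))"
      by (simp add: E_diff[OF X X])
    finally have "ell2_norm (\<lambda>n. X (Suc (Suc m)) n - X (Suc m) n)
        \<le> K * ell2_norm (E (\<lambda>n. X m n - X (Suc m) n))"
      using K(2)[OF E(1)[OF ell2_diff(1)[OF X X]]] by simp
    also have "\<dots> \<le> K * (\<epsilon> * ell2_norm (\<lambda>n. X m n - X (Suc m) n))"
      using K(1) E(2)[OF ell2_diff(1)[OF X X]] by simp
    also have "\<dots> \<le> \<theta> * (c * \<theta> ^ m)"
      using mult_left_mono[OF Suc.IH \<theta>(1)]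
      by (simp add: ell2_norm_minus_commute[of "X m"] \<theta>_def mult.assoc)
    finally show ?case by (simp add: mult_ac)
  qed
  obtain x where x: "x \<in> ell2" "\<And>m. ell2_norm (\<lambda>n. x n - X m n) \<le> c / (1 - \<theta>) * \<theta> ^ m"
    using ell2_geometric_convergent[OF X \<theta> _ step] ell2_norm_nonneg[OF ell2_diff(1)[OF X X]]
    by (metis c_def)
  obtain K' where K': "0 < K'" "\<And>x. x \<in> ell2 \<Longrightarrow> ell2_norm (A' x) \<le> K' * ell2_norm x"
    using bounded_op_bound[OF A'] by metis
  obtain KA where KA: "0 < KA" "\<And>x. x \<in> ell2 \<Longrightarrow> ell2_norm (A x) \<le> KA * ell2_norm x"
    using bounded_op_bound[OF A] by metis
  \<comment> \<open>\<open>A' x - y\<close> is \<open>A' (x - X m)\<close> plus the defect \<open>A (X m - X (m + 1))\<close> of the \<open>m\<close>-th iterate.\<close>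
  have bound: "ell2_norm (\<lambda>n. A' x n - y n) \<le> (K' * (c / (1 - \<theta>)) + KA * c) * \<theta> ^ m" for m
  proof -
    have "A (X (Suc m)) = (\<lambda>n. y n - E (X m) n)"
      unfolding X_Suc by (intro AB ell2_diff y E X)
    then have "A' (X m) n - y n = A (X m) n - A (X (Suc m)) n" for n
      by (simp add: E_def)
    then have eq: "(\<lambda>n. A' x n - y n) =
        (\<lambda>n. A' (\<lambda>n. x n - X m n) n - A (\<lambda>n. X (Suc m) n - X m n) n)"
      unfolding bounded_op_diff[OF A' x(1) X] bounded_op_diff[OF A X X]
      by (auto simp: algebra_simps fun_eq_iff)
    have "ell2_norm (\<lambda>n. A' x n - y n) \<le> ell2_norm (A' (\<lambda>n. x n - X m n))
        + ell2_norm (A (\<lambda>n. X (Suc m) n - X m n))"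
      unfolding eq by (intro ell2_diff A2 x X)
    also have "\<dots> \<le> K' * (c / (1 - \<theta>) * \<theta> ^ m) + KA * (c * \<theta> ^ m)"
    proof (intro add_mono)
      show "ell2_norm (A' (\<lambda>n. x n - X m n)) \<le> K' * (c / (1 - \<theta>) * \<theta> ^ m)"
        using K'(2)[OF ell2_diff(1)[OF x(1) X]] mult_left_mono[OF x(2)] K'(1)
        by (meson less_imp_le order_trans)
      show "ell2_norm (A (\<lambda>n. X (Suc m) n - X m n)) \<le> KA * (c * \<theta> ^ m)"
        using KA(2)[OF ell2_diff(1)[OF X X]] mult_left_mono[OF step] KA(1)
        by (meson less_imp_le order_trans)
    qed
    finally show ?thesis by (simp add: algebra_simps)
  qed
  have "(\<lambda>m. (K' * (c / (1 - \<theta>)) + KA * c) * \<theta> ^ m) \<longlonglongrightarrow> (K' * (c / (1 - \<theta>)) + KA * c) * 0"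
    using \<theta> by (intro tendsto_intros LIMSEQ_realpow_zero)
  from LIMSEQ_le_const[OF this, of "ell2_norm (\<lambda>n. A' x n - y n)"] bound
  have "ell2_norm (\<lambda>n. A' x n - y n) \<le> 0" by simp
  from ell2_norm_eq_0D[OF ell2_diff(1)[OF A2(2)[OF x(1)] y] this] have "A' x = y"
    by (metis eq_iff_diff_eq_0 ext)
  with x(1) show "\<exists>x\<in>ell2. A' x = y" by blast
qed

section \<open>Toeplitz operators with continuous symbols\<close>

lemma cis_in_circle [simp]: "cis v \<in> sphere 0 1"
  by simp

lemma circle_cases:
  assumes "t \<in> sphere 0 1"
  obtains v where "t = cis v" "0 \<le> v" "v < 2 * pi"
  using assms Arg2pi[of t] complex_norm_eq_1_exp[of t]
  by (metis cis_conv_exp dist_0_norm mem_sphere)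

lemma continuous_on_cis_compose:
  assumes "continuous_on (sphere 0 1) a"
  shows "continuous_on A (\<lambda>v. a (cis v))"
  by (rule continuous_on_compose2[OF assms]) (auto intro!: continuous_intros)

lemma fourier_integrable:
  assumes "continuous_on (sphere 0 1) a"
  shows "(\<lambda>v. a (cis v) * cis (- (of_int k * v))) integrable_on {0..2*pi}"
  by (intro integrable_continuous_interval continuous_intros continuous_on_cis_compose assms)

lemma fourier_has_integral:
  assumes "continuous_on (sphere 0 1) a"
  shows "((\<lambda>v. a (cis v) * cis (- (of_int k * v))) has_integral (2 * pi * fourier_coeff a k)) {0..2*pi}"
  using integrable_integral[OF fourier_integrable[OF assms]]
  by (simp add: fourier_coeff_def)

lemma fourier_coeff_cong:
  assumes "\<And>t. t \<in> sphere 0 1 \<Longrightarrow> f t = g t"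
  shows "fourier_coeff f = fourier_coeff g"
  using assms by (auto simp: fourier_coeff_def fun_eq_iff)

lemma toeplitz_cong:
  assumes "\<And>t. t \<in> sphere 0 1 \<Longrightarrow> f t = g t"
  shows "toeplitz f = toeplitz g"
  by (rule ext) (simp only: toeplitz_def fourier_coeff_cong[of f g, OF assms])

lemma fourier_coeff_linear:
  assumes "continuous_on (sphere 0 1) f" "continuous_on (sphere 0 1) g"
  shows "fourier_coeff (\<lambda>t. f t + c * g t) k = fourier_coeff f k + c * fourier_coeff g k"
proof -
  have "((\<lambda>v. f (cis v) * cis (- (of_int k * v)) + c * (g (cis v) * cis (- (of_int k * v))))
      has_integral (2 * pi * fourier_coeff f k + c * (2 * pi * fourier_coeff g k))) {0..2*pi}"
    by (intro has_integral_add has_integral_mult_right fourier_has_integral assms)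
  then have "integral {0..2*pi} (\<lambda>v. (f (cis v) + c * g (cis v)) * cis (- (of_int k * v)))
      = 2 * pi * (fourier_coeff f k + c * fourier_coeff g k)"
    by (intro integral_unique) (simp add: algebra_simps)
  then show ?thesis by (simp add: fourier_coeff_def[of "\<lambda>t. f t + c * g t"])
qed

lemma fourier_coeff_shift:
  "fourier_coeff (\<lambda>t. f t * t) k = fourier_coeff f (k - 1)"
  "fourier_coeff (\<lambda>t. f t / t) k = fourier_coeff f (k + 1)"
proof -
  have "f (cis v) * cis v * cis (- (of_int k * v)) = f (cis v) * cis (- (of_int (k - 1) * v))" for v
    by (simp add: mult.assoc cis_mult algebra_simps)
  then show "fourier_coeff (\<lambda>t. f t * t) k = fourier_coeff f (k - 1)"
    by (simp only: fourier_coeff_def)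
  have "f (cis v) / cis v * cis (- (of_int k * v)) = f (cis v) * cis (- (of_int (k + 1) * v))" for v
    unfolding divide_inverse cis_inverse mult.assoc cis_mult by (simp add: algebra_simps)
  then show "fourier_coeff (\<lambda>t. f t / t) k = fourier_coeff f (k + 1)"
    by (simp only: fourier_coeff_def)
qed

lemma cis_has_integral:
  "((\<lambda>v. cis (of_int m * v)) has_integral (if m = 0 then 2 * pi else 0)) {0..2*pi}"
proof (cases "m = 0")
  case True
  then show ?thesis
    using has_integral_const_real[of "1::complex" 0 "2*pi"]
    by (simp add: scaleR_conv_of_real)
next
  case False
  have "((\<lambda>v. cis (of_int m * v)) has_integral
      (cis (of_int m * (2 * pi)) / (\<i> * of_int m) - cis (of_int m * 0) / (\<i> * of_int m))) {0..2*pi}"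
  proof (rule fundamental_theorem_of_calculus)
    fix v :: real
    show "((\<lambda>v. cis (of_int m * v) / (\<i> * of_int m)) has_vector_derivative cis (of_int m * v))
        (at v within {0..2*pi})"
      using False unfolding cis_conv_exp
      by (auto intro!: derivative_eq_intros has_vector_derivative_real_field simp: scaleR_conv_of_real mult.commute mult.left_commute)
  qed simp
  moreover have "cis (of_int m * (2 * pi)) = 1"
    using cis_multiple_2pi[of "of_int m"] by (simp add: mult_ac)
  ultimately show ?thesis using False by simp
qed

lemma fourier_coeff_monomial:
  "fourier_coeff (\<lambda>t. t ^ m / t ^ n) k = (if k = int m - int n then 1 else 0)"
proof -
  have "cis v ^ m / cis v ^ n * cis (- (of_int k * v)) = cis (of_int (int m - int n - k) * v)" for v
    unfolding Complex.DeMoivre divide_inverse cis_inverse cis_mult by (simp add: algebra_simps)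
  then have "fourier_coeff (\<lambda>t. t ^ m / t ^ n) k
      = integral {0..2*pi} (\<lambda>v. cis (of_int (int m - int n - k) * v)) / of_real (2 * pi)"
    by (simp add: fourier_coeff_def)
  also have "\<dots> = (if k = int m - int n then 1 else 0)"
    unfolding integral_unique[OF cis_has_integral] by simp
  finally show ?thesis .
qed

definition trig_sum :: "nat set \<Rightarrow> (nat \<Rightarrow> complex) \<Rightarrow> real \<Rightarrow> complex" where
  "trig_sum F x v = (\<Sum>k\<in>F. x k * cis (real k * v))"

lemma trig_sum_parseval:
  assumes "finite F"
  shows "((\<lambda>v. (cmod (trig_sum F x v))\<^sup>2) has_integral (2 * pi * (\<Sum>k\<in>F. (cmod (x k))\<^sup>2))) {0..2*pi}"
proof -
  have "((\<lambda>v. \<Sum>k\<in>F. \<Sum>l\<in>F. x k * cnj (x l) * cis (of_int (int k - int l) * v)) has_integral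
      (\<Sum>k\<in>F. \<Sum>l\<in>F. x k * cnj (x l) * (if int k - int l = 0 then 2 * pi else 0))) {0..2*pi}"
    by (intro has_integral_sum assms has_integral_mult_right cis_has_integral)
  also have "(\<lambda>v. \<Sum>k\<in>F. \<Sum>l\<in>F. x k * cnj (x l) * cis (of_int (int k - int l) * v))
      = (\<lambda>v. of_real ((cmod (trig_sum F x v))\<^sup>2))"
  proof
    fix v
    have "of_real ((cmod (trig_sum F x v))\<^sup>2) = trig_sum F x v * cnj (trig_sum F x v)"
      by (rule complex_norm_square)
    also have "\<dots> = (\<Sum>k\<in>F. \<Sum>l\<in>F. (x k * cis (real k * v)) * (cnj (x l) * cis (- (real l * v))))"
      unfolding trig_sum_def cnj_sum sum_product by (simp add: cis_cnj)
    also have "\<dots> = (\<Sum>k\<in>F. \<Sum>l\<in>F. x k * cnj (x l) * cis (of_int (int k - int l) * v))"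
    proof (intro sum.cong refl)
      fix k l
      have "cis (real k * v) * cis (- (real l * v)) = cis (of_int (int k - int l) * v)"
        unfolding cis_mult by (simp add: algebra_simps)
      then show "(x k * cis (real k * v)) * (cnj (x l) * cis (- (real l * v)))
          = x k * cnj (x l) * cis (of_int (int k - int l) * v)"
        by (simp add: mult_ac)
    qed
    finally show "(\<Sum>k\<in>F. \<Sum>l\<in>F. x k * cnj (x l) * cis (of_int (int k - int l) * v))
        = of_real ((cmod (trig_sum F x v))\<^sup>2)" by simp
  qed
  also have "(\<Sum>k\<in>F. \<Sum>l\<in>F. x k * cnj (x l) * (if int k - int l = 0 then 2 * pi else 0))
      = (\<Sum>k\<in>F. of_real (2 * pi * (cmod (x k))\<^sup>2))"
  proof (rule sum.cong[OF refl])
    fix k assume "k \<in> F"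
    have "(\<Sum>l\<in>F. x k * cnj (x l) * (if int k - int l = 0 then 2 * pi else 0))
        = (\<Sum>l\<in>F. if k = l then x k * cnj (x k) * (2 * pi) else 0)"
      by (rule sum.cong) auto
    also have "\<dots> = x k * cnj (x k) * (2 * pi)"
      using \<open>k \<in> F\<close> assms by simp
    also have "\<dots> = of_real (2 * pi * (cmod (x k))\<^sup>2)"
      unfolding complex_norm_square[symmetric] by simp
    finally show "(\<Sum>l\<in>F. x k * cnj (x l) * (if int k - int l = 0 then 2 * pi else 0))
        = of_real (2 * pi * (cmod (x k))\<^sup>2)" .
  qed
  finally have "((\<lambda>v. complex_of_real ((cmod (trig_sum F x v))\<^sup>2)) has_integral
      (\<Sum>k\<in>F. of_real (2 * pi * (cmod (x k))\<^sup>2))) {0..2*pi}" .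
  from has_integral_linear[OF this bounded_linear_Re] show ?thesis
    by (simp add: o_def sum_distrib_left)
qed

text \<open>With \<open>X\<close> and \<open>Y\<close> the trigonometric sums of \<open>x\<close> and of the image \<open>y\<close>, \<open>2\<pi>\<parallel>y\<parallel>\<^sup>2\<close> is the
  integral of \<open>a X\<close> times the conjugate of \<open>Y\<close>. Its modulus is at most
  \<open>\<integral> (M\<^sup>2 |X|\<^sup>2 + |Y|\<^sup>2) / 2 = \<pi> (M\<^sup>2 \<parallel>x\<parallel>\<^sup>2 + \<parallel>y\<parallel>\<^sup>2)\<close>, and \<open>\<parallel>y\<parallel>\<^sup>2\<close> is absorbed on the left. Finite
  sections come first because even the convergence of the rows is deduced from this bound.\<close>

lemma toeplitz_section_bound:
  assumes a: "continuous_on (sphere 0 1) a" and M: "\<And>t. t \<in> sphere 0 1 \<Longrightarrow> cmod (a t) \<le> M"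
    and F: "finite F" and G: "finite G"
  shows "(\<Sum>j\<in>G. (cmod (\<Sum>k\<in>F. fourier_coeff a (int j - int k) * x k))\<^sup>2)
           \<le> M\<^sup>2 * (\<Sum>k\<in>F. (cmod (x k))\<^sup>2)"
proof -
  define y where "y j = (\<Sum>k\<in>F. fourier_coeff a (int j - int k) * x k)" for j
  define S where "S = (\<Sum>j\<in>G. (cmod (y j))\<^sup>2)"
  let ?I = "\<lambda>v. a (cis v) * trig_sum F x v * cnj (trig_sum G y v)"
  have "((\<lambda>v. \<Sum>j\<in>G. \<Sum>k\<in>F. (x k * cnj (y j)) * (a (cis v) * cis (- (of_int (int j - int k) * v))))
      has_integral (\<Sum>j\<in>G. \<Sum>k\<in>F. (x k * cnj (y j)) * (2 * pi * fourier_coeff a (int j - int k)))) {0..2*pi}"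
    by (intro has_integral_sum F G has_integral_mult_right fourier_has_integral a)
  also have "(\<lambda>v. \<Sum>j\<in>G. \<Sum>k\<in>F. (x k * cnj (y j)) * (a (cis v) * cis (- (of_int (int j - int k) * v)))) = ?I"
  proof
    fix v
    have "?I v = a (cis v) * (\<Sum>k\<in>F. \<Sum>j\<in>G. (x k * cis (real k * v)) * (cnj (y j) * cis (- (real j * v))))"
      unfolding trig_sum_def cnj_sum mult.assoc sum_product by (simp add: cis_cnj)
    also have "\<dots> = (\<Sum>j\<in>G. \<Sum>k\<in>F. a (cis v) * ((x k * cis (real k * v)) * (cnj (y j) * cis (- (real j * v)))))"
      unfolding sum_distrib_left by (rule sum.swap)
    also have "\<dots> = (\<Sum>j\<in>G. \<Sum>k\<in>F. (x k * cnj (y j)) * (a (cis v) * cis (- (of_int (int j - int k) * v))))"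
    proof (intro sum.cong refl)
      fix j k
      have "cis (real k * v) * cis (- (real j * v)) = cis (- (of_int (int j - int k) * v))"
        unfolding cis_mult by (simp add: algebra_simps)
      then show "a (cis v) * ((x k * cis (real k * v)) * (cnj (y j) * cis (- (real j * v))))
          = (x k * cnj (y j)) * (a (cis v) * cis (- (of_int (int j - int k) * v)))"
        by (simp add: mult_ac)
    qed
    finally show "(\<Sum>j\<in>G. \<Sum>k\<in>F. (x k * cnj (y j)) * (a (cis v) * cis (- (of_int (int j - int k) * v)))) = ?I v"
      by simp
  qed
  also have "(\<Sum>j\<in>G. \<Sum>k\<in>F. (x k * cnj (y j)) * (2 * pi * fourier_coeff a (int j - int k)))
      = (\<Sum>j\<in>G. of_real (2 * pi) * (y j * cnj (y j)))"
    unfolding y_def sum_distrib_left sum_distrib_right by (simp add: mult_ac)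
  also have "\<dots> = of_real (2 * pi * S)"
    unfolding S_def of_real_mult of_real_sum complex_norm_square sum_distrib_left ..
  finally have I: "(?I has_integral of_real (2 * pi * S)) {0..2*pi}" .
  have X: "((\<lambda>v. (cmod (trig_sum F x v))\<^sup>2) has_integral (2 * pi * (\<Sum>k\<in>F. (cmod (x k))\<^sup>2))) {0..2*pi}"
    and Y: "((\<lambda>v. (cmod (trig_sum G y v))\<^sup>2) has_integral (2 * pi * S)) {0..2*pi}"
    unfolding S_def by (intro trig_sum_parseval F G)+
  have XY: "((\<lambda>v. (M\<^sup>2 * (cmod (trig_sum F x v))\<^sup>2 + (cmod (trig_sum G y v))\<^sup>2) * (1 / 2)) has_integral
      (M\<^sup>2 * (2 * pi * (\<Sum>k\<in>F. (cmod (x k))\<^sup>2)) + 2 * pi * S) * (1 / 2)) {0..2*pi}"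
    by (intro has_integral_mult_left has_integral_add has_integral_mult_right X Y)
  have "norm (integral {0..2*pi} ?I)
      \<le> integral {0..2*pi} (\<lambda>v. (M\<^sup>2 * (cmod (trig_sum F x v))\<^sup>2 + (cmod (trig_sum G y v))\<^sup>2) * (1 / 2))"
  proof (rule integral_norm_bound_integral)
    fix v
    have "cmod (?I v) \<le> M * cmod (trig_sum F x v) * cmod (trig_sum G y v)"
      unfolding norm_mult complex_mod_cnj by (intro mult_right_mono M) auto
    also have "\<dots> \<le> (M\<^sup>2 * (cmod (trig_sum F x v))\<^sup>2 + (cmod (trig_sum G y v))\<^sup>2) * (1 / 2)"
      using sum_squares_bound[of "M * cmod (trig_sum F x v)" "cmod (trig_sum G y v)"]
      by (simp add: power_mult_distrib)
    finally show "cmod (?I v) \<le> \<dots>" .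
  qed (use I XY in blast)+
  then have "\<bar>2 * pi * S\<bar> \<le> (M\<^sup>2 * (2 * pi * (\<Sum>k\<in>F. (cmod (x k))\<^sup>2)) + 2 * pi * S) * (1 / 2)"
    unfolding integral_unique[OF I] integral_unique[OF XY] norm_of_real .
  also have "\<dots> = pi * (M\<^sup>2 * (\<Sum>k\<in>F. (cmod (x k))\<^sup>2) + S)"
    by (simp add: algebra_simps)
  finally have "pi * (2 * S) \<le> pi * (M\<^sup>2 * (\<Sum>k\<in>F. (cmod (x k))\<^sup>2) + S)"
    by linarith
  then have "2 * S \<le> M\<^sup>2 * (\<Sum>k\<in>F. (cmod (x k))\<^sup>2) + S"
    unfolding mult_le_cancel_left_pos[OF pi_gt_zero] .
  then show ?thesis by (simp add: S_def y_def)
qed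

lemma circle_bounded:
  fixes a :: "complex \<Rightarrow> complex"
  assumes "continuous_on (sphere 0 1) a"
  obtains M :: real where "0 < M" "\<And>t. t \<in> sphere 0 1 \<Longrightarrow> cmod (a t) \<le> M"
proof -
  have "bounded (a ` sphere 0 1)"
    by (intro compact_imp_bounded compact_continuous_image assms compact_sphere)
  then show thesis using that unfolding bounded_pos by blast
qed

lemma toeplitz_summable:
  assumes a: "continuous_on (sphere 0 1) a" and x: "x \<in> ell2"
  shows "summable (\<lambda>k. fourier_coeff a (int j - int k) * x k)"
  unfolding summable_Cauchy
proof (intro allI impI)
  fix e :: real assume e: "0 < e"
  obtain M where M: "0 < M" "\<And>t. t \<in> sphere 0 1 \<Longrightarrow> cmod (a t) \<le> M"
    using circle_bounded[OF a] by metis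
  have "0 < (e / M)\<^sup>2" using e M by simp
  then obtain N where N: "\<And>m n. m \<ge> N \<Longrightarrow> norm (\<Sum>k=m..<n. (cmod (x k))\<^sup>2) < (e / M)\<^sup>2"
    using x unfolding ell2_def mem_Collect_eq summable_Cauchy by metis
  show "\<exists>N. \<forall>m\<ge>N. \<forall>n. norm (\<Sum>k=m..<n. fourier_coeff a (int j - int k) * x k) < e"
  proof (intro exI allI impI)
    fix m n assume "N \<le> m"
    have "(norm (\<Sum>k=m..<n. fourier_coeff a (int j - int k) * x k))\<^sup>2 \<le> M\<^sup>2 * (\<Sum>k=m..<n. (cmod (x k))\<^sup>2)"
      using toeplitz_section_bound[OF a M(2), of "{m..<n}" "{j}" x] by simp
    also have "\<dots> < M\<^sup>2 * (e / M)\<^sup>2"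
      using N[OF \<open>N \<le> m\<close>, of n] M(1) by (intro mult_strict_left_mono) auto
    also have "\<dots> = e\<^sup>2" using M(1) by (simp add: power_divide)
    finally show "norm (\<Sum>k=m..<n. fourier_coeff a (int j - int k) * x k) < e"
      using e by (simp add: power_less_imp_less_base)
  qed
qed

lemma toeplitz_norm_bound:
  assumes a: "continuous_on (sphere 0 1) a" and M: "\<And>t. t \<in> sphere 0 1 \<Longrightarrow> cmod (a t) \<le> M"
    and x: "x \<in> ell2"
  shows "toeplitz a x \<in> ell2" and "ell2_norm (toeplitz a x) \<le> M * ell2_norm x"
proof -
  have M0: "0 \<le> M" using M[of 1] by (auto intro: order_trans[OF norm_ge_zero])
  have "(\<Sum>j<J. (cmod (toeplitz a x j))\<^sup>2) \<le> (M * ell2_norm x)\<^sup>2" for J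
  proof (rule LIMSEQ_le_const2)
    show "(\<lambda>N. \<Sum>j<J. (cmod (\<Sum>k<N. fourier_coeff a (int j - int k) * x k))\<^sup>2)
        \<longlonglongrightarrow> (\<Sum>j<J. (cmod (toeplitz a x j))\<^sup>2)"
      unfolding toeplitz_def
      by (intro tendsto_intros summable_LIMSEQ toeplitz_summable a x)
    have "(\<Sum>j<J. (cmod (\<Sum>k<N. fourier_coeff a (int j - int k) * x k))\<^sup>2)
        \<le> (M * ell2_norm x)\<^sup>2" for N
      using toeplitz_section_bound[OF a M, of "{..<N}" "{..<J}" x]
        mult_left_mono[OF ell2_sum_le[OF x, of "{..<N}"], of "M\<^sup>2"]
      by (simp add: power_mult_distrib)
    then show "\<exists>N. \<forall>n\<ge>N. (\<Sum>j<J. (cmod (\<Sum>k<n. fourier_coeff a (int j - int k) * x k))\<^sup>2)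
        \<le> (M * ell2_norm x)\<^sup>2" by blast
  qed
  from ell2I[OF _ this] show "toeplitz a x \<in> ell2" "ell2_norm (toeplitz a x) \<le> M * ell2_norm x"
    using M0 ell2_norm_nonneg[OF x] by simp_all
qed

lemma bounded_op_toeplitz:
  assumes a: "continuous_on (sphere 0 1) a"
  shows "bounded_op (toeplitz a)"
proof -
  obtain M where M: "0 < M" "\<And>t. t \<in> sphere 0 1 \<Longrightarrow> cmod (a t) \<le> M"
    using circle_bounded[OF a] by metis
  show ?thesis
    unfolding bounded_op_def
  proof (intro conjI ballI allI exI)
    fix x y assume xy: "x \<in> ell2" "y \<in> ell2"
    show "toeplitz a x \<in> ell2" "ell2_norm (toeplitz a x) \<le> M * ell2_norm x"
      using toeplitz_norm_bound[OF a M(2) xy(1)] by simp_all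
    show "toeplitz a (\<lambda>n. x n + y n) = (\<lambda>n. toeplitz a x n + toeplitz a y n)"
      unfolding toeplitz_def
      by (simp add: distrib_left suminf_add[OF toeplitz_summable[OF a] toeplitz_summable[OF a]] xy)
  next
    fix c x assume x: "x \<in> ell2"
    show "toeplitz a (\<lambda>n. c * x n) = (\<lambda>n. c * toeplitz a x n)"
      unfolding toeplitz_def
      by (simp add: suminf_mult[OF toeplitz_summable[OF a x]] mult.left_commute)
  qed
qed

lemma toeplitz_symbol_linear:
  assumes f: "continuous_on (sphere 0 1) f" and g: "continuous_on (sphere 0 1) g" and x: "x \<in> ell2"
  shows "toeplitz (\<lambda>t. f t + c * g t) x = (\<lambda>n. toeplitz f x n + c * toeplitz g x n)"
  unfolding toeplitz_def fourier_coeff_linear[OF f g]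
  by (simp add: distrib_right mult.assoc suminf_add toeplitz_summable f g x
      suminf_mult summable_mult flip: suminf_mult)

lemma toeplitz_monomial:
  "toeplitz (\<lambda>t. t ^ m / t ^ n) x j = (if m \<le> j + n then x (j + n - m) else 0)"
proof (cases "m \<le> j + n")
  case True
  have "toeplitz (\<lambda>t. t ^ m / t ^ n) x j = (\<Sum>k\<in>{j + n - m}. fourier_coeff (\<lambda>t. t ^ m / t ^ n) (int j - int k) * x k)"
    unfolding toeplitz_def
    by (rule suminf_finite) (use True in \<open>auto simp: fourier_coeff_monomial\<close>)
  then show ?thesis using True by (simp add: fourier_coeff_monomial)
next
  case False
  then have "int j - int k \<noteq> int m - int n" for k by auto
  then show ?thesis using False by (simp add: toeplitz_def fourier_coeff_monomial)
qed

lemma toeplitz_one: "toeplitz (\<lambda>t. 1) x = x"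
  using toeplitz_monomial[of 0 0 x] by (simp add: fun_eq_iff)

lemma toeplitz_const: "x \<in> ell2 \<Longrightarrow> toeplitz (\<lambda>t. c) x = (\<lambda>n. c * x n)"
  using toeplitz_symbol_linear[of "\<lambda>t. 0" "\<lambda>t. 1" x c]
  by (simp add: toeplitz_one) (simp add: toeplitz_def fourier_coeff_def)

lemma toeplitz_mult_shift:
  assumes f: "continuous_on (sphere 0 1) f" and x: "x \<in> ell2"
  shows "toeplitz (\<lambda>t. f t * t) x = toeplitz f (toeplitz (\<lambda>t. t) x)"
proof -
  define y where "y = toeplitz (\<lambda>t. t) x"
  have y: "y \<in> ell2" unfolding y_def
    by (rule bounded_opD(1)[OF bounded_op_toeplitz]) (auto intro: x continuous_intros)
  have y0: "y 0 = 0" "y (Suc k) = x k" for k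
    using toeplitz_monomial[of 1 0 x] unfolding y_def by simp_all
  have "toeplitz f y j = toeplitz (\<lambda>t. f t * t) x j" for j
    unfolding toeplitz_def fourier_coeff_shift
    using suminf_split_head[OF toeplitz_summable[OF f y, of j]] y0
    by (simp add: algebra_simps)
  then show ?thesis by (simp add: y_def fun_eq_iff)
qed

lemma toeplitz_div_shift: "toeplitz (\<lambda>t. f t / t) x j = toeplitz f x (Suc j)"
  unfolding toeplitz_def fourier_coeff_shift by (simp add: algebra_simps)

lemma sp_toeplitz_iff:
  assumes a: "continuous_on (sphere 0 1) a"
  shows "\<mu> \<in> sp_toeplitz a \<longleftrightarrow> \<not> invertible_op (toeplitz (\<lambda>t. a t - \<mu>))"
proof -
  have "toeplitz (\<lambda>t. a t - \<mu>) x = (\<lambda>n. toeplitz a x n - \<mu> * x n)" if "x \<in> ell2" for x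
    using toeplitz_symbol_linear[OF a continuous_on_const[of _ 1] that, of "- \<mu>"]
    by (simp add: toeplitz_one)
  then show ?thesis
    unfolding sp_toeplitz_def op_spectrum_def mem_Collect_eq
    by (subst invertible_op_cong[of "toeplitz (\<lambda>t. a t - \<mu>)"]) auto
qed

lemma toeplitz_diff_bound:
  assumes f: "continuous_on (sphere 0 1) f" and g: "continuous_on (sphere 0 1) g"
    and le: "\<And>t. t \<in> sphere 0 1 \<Longrightarrow> cmod (g t - f t) \<le> \<eta>" and x: "x \<in> ell2"
  shows "ell2_norm (\<lambda>n. toeplitz g x n - toeplitz f x n) \<le> \<eta> * ell2_norm x"
proof -
  have c: "continuous_on (sphere 0 1) (\<lambda>t. g t + (- 1) * f t)"
    using f g by (intro continuous_intros)
  have "cmod (g t + (- 1) * f t) \<le> \<eta>" if "t \<in> sphere 0 1" for t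
    using le[OF that] by simp
  from toeplitz_norm_bound(2)[OF c this x] show ?thesis
    unfolding toeplitz_symbol_linear[OF g f x] by simp
qed

lemma toeplitz_invertible_stable:
  assumes f: "continuous_on (sphere 0 1) f" and inv: "invertible_op (toeplitz f)"
  obtains \<eta> where "0 < \<eta>"
    "\<And>g. continuous_on (sphere 0 1) g \<Longrightarrow> (\<And>t. t \<in> sphere 0 1 \<Longrightarrow> cmod (g t - f t) \<le> \<eta>)
       \<Longrightarrow> invertible_op (toeplitz g)"
proof -
  obtain B where B: "bounded_op B" "\<And>x. x \<in> ell2 \<Longrightarrow> B (toeplitz f x) = x"
    "\<And>x. x \<in> ell2 \<Longrightarrow> toeplitz f (B x) = x"
    using invertible_opE[OF inv] by metis
  obtain K where K: "0 < K" "\<And>x. x \<in> ell2 \<Longrightarrow> ell2_norm (B x) \<le> K * ell2_norm x"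
    using bounded_op_bound[OF B(1)] by metis
  show thesis
  proof
    show "0 < 1 / (2 * K)" using K by simp
    fix g assume g: "continuous_on (sphere 0 1) g"
      and le: "\<And>t. t \<in> sphere 0 1 \<Longrightarrow> cmod (g t - f t) \<le> 1 / (2 * K)"
    show "invertible_op (toeplitz g)"
      by (rule invertible_op_perturb[OF bounded_op_toeplitz[OF f] B K bounded_op_toeplitz[OF g]
            _ toeplitz_diff_bound[OF f g le]]) (use K in auto)
  qed
qed

lemma toeplitz_invertible_near_one:
  assumes g: "continuous_on (sphere 0 1) g" and less: "\<And>t. t \<in> sphere 0 1 \<Longrightarrow> cmod (g t - 1) < 1"
  shows "invertible_op (toeplitz g)"
proof -
  obtain s :: complex where s: "s \<in> sphere 0 1" "\<And>t. t \<in> sphere 0 1 \<Longrightarrow> cmod (g t - 1) \<le> cmod (g s - 1)"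
  proof -
    have "continuous_on (sphere 0 1) (\<lambda>t. cmod (g t - 1))"
      using g by (intro continuous_intros)
    moreover have "sphere (0::complex) 1 \<noteq> {}" using cis_in_circle[of 0] by blast
    ultimately show thesis
      using continuous_attains_sup[OF compact_sphere] that by blast
  qed
  have id: "bounded_op (\<lambda>x. x)"
    by (auto simp: bounded_op_def intro!: exI[of _ 1])
  have "bounded_op (toeplitz (\<lambda>t. 1))" by (intro bounded_op_toeplitz continuous_intros)
  from invertible_op_perturb[OF this id, where K = 1 and \<epsilon> = "cmod (g s - 1)" and A' = "toeplitz g"]
  show ?thesis
    using toeplitz_diff_bound[OF _ g s(2)] bounded_op_toeplitz[OF g] less[OF s(1)]
    by (simp add: toeplitz_one)
qed

section \<open>Invertibility is stable under multiplication of the symbol\<close>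

text \<open>For Laurent polynomials without zeros on the circle this means winding number 0 about the origin.
  Stated through operators, the condition involves no curves and is visibly multiplicative.\<close>

definition neutral_symbol :: "(complex \<Rightarrow> complex) \<Rightarrow> bool" where
  "neutral_symbol g \<longleftrightarrow> continuous_on (sphere 0 1) g \<and> (\<forall>t\<in>sphere 0 1. g t \<noteq> 0) \<and>
     (\<forall>f. continuous_on (sphere 0 1) f \<longrightarrow>
        (invertible_op (toeplitz (\<lambda>t. f t * g t)) \<longleftrightarrow> invertible_op (toeplitz f)))"

lemma neutral_symbol_mult:
  assumes "neutral_symbol g" "neutral_symbol h"
  shows "neutral_symbol (\<lambda>t. g t * h t)"
proof -
  have "invertible_op (toeplitz (\<lambda>t. f t * (g t * h t))) \<longleftrightarrow> invertible_op (toeplitz f)"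
    if f: "continuous_on (sphere 0 1) f" for f
  proof -
    have "continuous_on (sphere 0 1) (\<lambda>t. f t * g t)"
      using f assms(1) by (auto simp: neutral_symbol_def intro: continuous_on_mult)
    then show ?thesis
      using assms f by (simp add: neutral_symbol_def flip: mult.assoc)
  qed
  then show ?thesis
    using assms by (auto simp: neutral_symbol_def intro: continuous_on_mult)
qed

lemma neutral_symbol_cong:
  assumes "\<And>t. t \<in> sphere 0 1 \<Longrightarrow> g t = h t" and "neutral_symbol h"
  shows "neutral_symbol g"
proof -
  have "toeplitz (\<lambda>t. f t * g t) = toeplitz (\<lambda>t. f t * h t)" for f
    by (rule toeplitz_cong) (simp only: assms(1))
  moreover have "continuous_on (sphere 0 1) g \<longleftrightarrow> continuous_on (sphere 0 1) h"
    by (rule continuous_on_cong) (simp_all only: assms(1))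
  ultimately show ?thesis
    using assms unfolding neutral_symbol_def by metis
qed

lemma neutral_symbol_const:
  assumes "c \<noteq> 0"
  shows "neutral_symbol (\<lambda>t. c)"
proof -
  have scale: "bounded_op (\<lambda>x n. d * x n)" for d
    by (rule bounded_op_cong[OF bounded_op_toeplitz[OF continuous_on_const[of _ d]]])
      (simp add: toeplitz_const)
  have inv: "invertible_op (\<lambda>x n. c * x n)"
    unfolding invertible_op_def
    by (intro conjI scale exI[of _ "\<lambda>x n. inverse c * x n"]) (use assms in auto)
  have "invertible_op (toeplitz (\<lambda>t. f t * c)) \<longleftrightarrow> invertible_op (toeplitz f)"
    if f: "continuous_on (sphere 0 1) f" for f
  proof -
    have "toeplitz (\<lambda>t. f t * c) x = (\<lambda>n. c * toeplitz f x n)" if "x \<in> ell2" for x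
      using toeplitz_symbol_linear[OF continuous_on_const[of _ 0] f that, of c]
      by (simp add: toeplitz_const[OF that, of 0] mult.commute)
    then have "invertible_op (toeplitz (\<lambda>t. f t * c)) \<longleftrightarrow> invertible_op (\<lambda>x n. c * toeplitz f x n)"
      by (rule invertible_op_cong)
    also have "\<dots> \<longleftrightarrow> invertible_op (toeplitz f)"
      by (rule invertible_op_compose_iff(2)[OF bounded_op_toeplitz[OF f] inv])
    finally show ?thesis .
  qed
  then show ?thesis using assms by (simp add: neutral_symbol_def)
qed

lemma neutral_symbol_invertible:
  assumes "neutral_symbol g"
  shows "invertible_op (toeplitz g)"
proof -
  have "invertible_op (toeplitz (\<lambda>t. 1))"
    by (rule toeplitz_invertible_near_one) auto
  moreover have "invertible_op (toeplitz (\<lambda>t. 1 * g t)) \<longleftrightarrow> invertible_op (toeplitz (\<lambda>t. 1))"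
    using assms unfolding neutral_symbol_def by (blast intro: continuous_on_const)
  ultimately show ?thesis by simp
qed

lemma circle_nonzero: "t \<in> sphere (0::complex) 1 \<Longrightarrow> t \<noteq> 0"
  by auto

text \<open>An analytic factor splits off on the right of a Toeplitz operator, an anti-analytic one on the left;
  for \<open>|w| < 1\<close> the operator of the factor is invertible by a Neumann series.\<close>

lemma neutral_symbol_analytic_factor:
  assumes w: "cmod w < 1"
  shows "neutral_symbol (\<lambda>t. 1 - w * t)"
proof -
  have cont: "continuous_on (sphere 0 1) (\<lambda>t. 1 - w * t)" by (intro continuous_intros)
  have "cmod (1 - w * t - 1) < 1" if "t \<in> sphere 0 1" for t
    using w that by (simp add: norm_mult)
  from toeplitz_invertible_near_one[OF cont this]
  have inv: "invertible_op (toeplitz (\<lambda>t. 1 - w * t))" .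
  have "invertible_op (toeplitz (\<lambda>t. f t * (1 - w * t))) \<longleftrightarrow> invertible_op (toeplitz f)"
    if f: "continuous_on (sphere 0 1) f" for f
  proof -
    have "toeplitz (\<lambda>t. f t * (1 - w * t)) x = toeplitz f (toeplitz (\<lambda>t. 1 - w * t) x)"
      if x: "x \<in> ell2" for x
    proof -
      have id: "continuous_on (sphere 0 1) (\<lambda>t::complex. t)" by (intro continuous_intros)
      have ft: "continuous_on (sphere 0 1) (\<lambda>t. f t * t)" using f by (intro continuous_intros)
      have Sx: "toeplitz (\<lambda>t. t) x \<in> ell2" by (rule bounded_opD(1)[OF bounded_op_toeplitz[OF id] x])
      have "toeplitz (\<lambda>t. f t * (1 - w * t)) x = toeplitz (\<lambda>t. f t + (- w) * (f t * t)) x"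
        by (simp add: algebra_simps)
      also have "\<dots> = (\<lambda>n. toeplitz f x n + (- w) * toeplitz f (toeplitz (\<lambda>t. t) x) n)"
        unfolding toeplitz_symbol_linear[OF f ft x] toeplitz_mult_shift[OF f x] ..
      also have "\<dots> = toeplitz f (\<lambda>n. x n + (- w) * toeplitz (\<lambda>t. t) x n)"
        unfolding bounded_opD(2)[OF bounded_op_toeplitz[OF f] x ell2_scale(1)[OF Sx]]
          bounded_opD(3)[OF bounded_op_toeplitz[OF f] Sx] ..
      also have "(\<lambda>n. x n + (- w) * toeplitz (\<lambda>t. t) x n) = toeplitz (\<lambda>t. 1 - w * t) x"
        using toeplitz_symbol_linear[OF continuous_on_const[of _ 1] id x, of "- w"]
        by (simp add: toeplitz_one)
      finally show ?thesis .
    qed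
    then have "invertible_op (toeplitz (\<lambda>t. f t * (1 - w * t)))
        \<longleftrightarrow> invertible_op (\<lambda>x. toeplitz f (toeplitz (\<lambda>t. 1 - w * t) x))"
      by (rule invertible_op_cong)
    also have "\<dots> \<longleftrightarrow> invertible_op (toeplitz f)"
      by (rule invertible_op_compose_iff(1)[OF bounded_op_toeplitz[OF f] inv])
    finally show ?thesis .
  qed
  moreover have "1 - w * t \<noteq> 0" if "t \<in> sphere 0 1" for t
    using \<open>\<And>t. t \<in> sphere 0 1 \<Longrightarrow> cmod (1 - w * t - 1) < 1\<close>[OF that] by auto
  ultimately show ?thesis using cont by (simp add: neutral_symbol_def)
qed

lemma toeplitz_antianalytic_factor:
  assumes f: "continuous_on (sphere 0 1) f" and x: "x \<in> ell2"
  shows "toeplitz (\<lambda>t. f t * (1 - w / t)) x = (\<lambda>j. toeplitz f x j - w * toeplitz f x (Suc j))"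
proof -
  have ft: "continuous_on (sphere 0 1) (\<lambda>t. f t / t)"
    using f circle_nonzero by (intro continuous_intros) auto
  have "toeplitz (\<lambda>t. f t * (1 - w / t)) x = toeplitz (\<lambda>t. f t + (- w) * (f t / t)) x"
    by (simp add: algebra_simps)
  then show ?thesis
    unfolding toeplitz_symbol_linear[OF f ft x] toeplitz_div_shift by simp
qed

lemma neutral_symbol_antianalytic_factor:
  assumes w: "cmod w < 1"
  shows "neutral_symbol (\<lambda>t. 1 - w / t)"
proof -
  have cont: "continuous_on (sphere 0 1) (\<lambda>t. 1 - w / t)"
    using circle_nonzero by (intro continuous_intros) auto
  have near: "cmod (1 - w / t - 1) < 1" if "t \<in> sphere 0 1" for t
    using w that by (simp add: norm_divide)
  from toeplitz_invertible_near_one[OF cont this]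
  have inv: "invertible_op (toeplitz (\<lambda>t. 1 - w / t))" .
  have "invertible_op (toeplitz (\<lambda>t. f t * (1 - w / t))) \<longleftrightarrow> invertible_op (toeplitz f)"
    if f: "continuous_on (sphere 0 1) f" for f
  proof -
    have "toeplitz (\<lambda>t. f t * (1 - w / t)) x = toeplitz (\<lambda>t. 1 - w / t) (toeplitz f x)"
      if x: "x \<in> ell2" for x
      using toeplitz_antianalytic_factor[OF continuous_on_const[of _ 1]
          bounded_opD(1)[OF bounded_op_toeplitz[OF f] x], of w]
      by (simp add: toeplitz_antianalytic_factor[OF f x] toeplitz_one)
    then have "invertible_op (toeplitz (\<lambda>t. f t * (1 - w / t)))
        \<longleftrightarrow> invertible_op (\<lambda>x. toeplitz (\<lambda>t. 1 - w / t) (toeplitz f x))"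
      by (rule invertible_op_cong)
    also have "\<dots> \<longleftrightarrow> invertible_op (toeplitz f)"
      by (rule invertible_op_compose_iff(2)[OF bounded_op_toeplitz[OF f] inv])
    finally show ?thesis .
  qed
  moreover have "1 - w / t \<noteq> 0" if "t \<in> sphere 0 1" for t
    using near[OF that] by auto
  ultimately show ?thesis using cont by (simp add: neutral_symbol_def)
qed

text \<open>A zero \<open>\<zeta>\<close> on the circle destroys surjectivity: if \<open>u\<close> is square summable and
  \<open>u\<^sub>j - \<zeta> u\<^sub>j\<^sub>+\<^sub>1 = \<zeta>\<^sup>-\<^sup>j / (j + 1)\<close>, then \<open>\<zeta>\<^sup>j u\<^sub>j\<close> is bounded, although its decrements are the
  terms of the harmonic series.\<close>

lemma toeplitz_circle_zero_not_invertible: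
  assumes f: "continuous_on (sphere 0 1) f" and \<zeta>: "\<zeta> \<in> sphere 0 1"
  shows "\<not> invertible_op (toeplitz (\<lambda>t. f t * (1 - \<zeta> / t)))"
proof
  assume inv: "invertible_op (toeplitz (\<lambda>t. f t * (1 - \<zeta> / t)))"
  define y where "y j = inverse (\<zeta> ^ j) * of_real (1 / real (Suc j))" for j
  have \<zeta>1: "cmod \<zeta> = 1" "\<zeta> \<noteq> 0" using \<zeta> by auto
  have "summable (\<lambda>n. inverse ((real (Suc n))\<^sup>2))"
    using inverse_power_summable[of 2, where 'a = real] by (subst summable_Suc_iff) simp
  then have y: "y \<in> ell2"
    by (simp add: ell2_def y_def norm_mult norm_inverse norm_power \<zeta>1 norm_divide power_divide
        inverse_eq_divide norm_of_real del: of_nat_Suc)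
  obtain x where x: "x \<in> ell2" "toeplitz (\<lambda>t. f t * (1 - \<zeta> / t)) x = y"
    using invertible_opE[OF inv] y bounded_opD(1) by metis
  define u where "u = toeplitz f x"
  have u: "u \<in> ell2" unfolding u_def by (rule bounded_opD(1)[OF bounded_op_toeplitz[OF f] x(1)])
  have rec: "u j - \<zeta> * u (Suc j) = y j" for j
    using x(2) unfolding toeplitz_antianalytic_factor[OF f x(1)] u_def by metis
  have dec: "\<zeta> ^ j * u j - \<zeta> ^ Suc j * u (Suc j) = of_real (1 / real (Suc j))" for j
  proof -
    have "\<zeta> ^ j * u j - \<zeta> ^ Suc j * u (Suc j) = \<zeta> ^ j * y j"
      unfolding rec[symmetric] by (simp add: algebra_simps)
    then show ?thesis using \<zeta>1 by (simp add: y_def)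
  qed
  have "(\<Sum>j<N. 1 / real (Suc j)) \<le> 2 * ell2_norm u" for N
  proof -
    have "complex_of_real (\<Sum>j<N. 1 / real (Suc j)) = \<zeta> ^ 0 * u 0 - \<zeta> ^ N * u N"
      unfolding of_real_sum dec[symmetric]
      by (rule sum_lessThan_telescope'[of "\<lambda>j. \<zeta> ^ j * u j"])
    then have "\<bar>\<Sum>j<N. 1 / real (Suc j)\<bar> = cmod (\<zeta> ^ 0 * u 0 - \<zeta> ^ N * u N)"
      by (metis norm_of_real)
    also have "\<dots> \<le> cmod (u 0) + cmod (u N)"
      using norm_triangle_ineq4[of "u 0" "\<zeta> ^ N * u N"] by (simp add: norm_mult norm_power \<zeta>1)
    also have "\<dots> \<le> 2 * ell2_norm u"
      using ell2_component_le[OF u, of 0] ell2_component_le[OF u, of N] by simp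
    finally show ?thesis by simp
  qed
  then have "summable (\<lambda>j. 1 / real (Suc j))"
    by (intro summableI_nonneg_bounded) auto
  then have "summable (\<lambda>j. 1 / real j)"
    by (subst (asm) summable_Suc_iff)
  then show False using not_summable_harmonic[where 'a = real] by (simp add: inverse_eq_divide)
qed

lemma ell2_unit: "(\<lambda>n. if n = 0 then 1 else 0) \<in> ell2"
  using summable_finite[of "{0}" "\<lambda>n. (cmod (if n = 0 then 1 else 0))\<^sup>2"] by (simp add: ell2_def)

lemma toeplitz_monomial_invertibleD:
  assumes inv: "invertible_op (toeplitz (\<lambda>t. t ^ m / t ^ n))"
  shows "m = n"
proof -
  define A where "A = toeplitz (\<lambda>t. t ^ m / t ^ n)"
  have A: "A x j = (if m \<le> j + n then x (j + n - m) else 0)" for x j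
    unfolding A_def by (rule toeplitz_monomial)
  define e where "e = (\<lambda>n::nat. if n = 0 then 1 else 0 :: complex)"
  have e: "e \<in> ell2" unfolding e_def by (rule ell2_unit)
  obtain B where B: "\<And>x. x \<in> ell2 \<Longrightarrow> B (A x) = x" "\<And>x. x \<in> ell2 \<Longrightarrow> A (B x) = x"
    by (rule invertible_opE[OF inv[folded A_def]]) (rule that)
  have "\<not> m < n"
  proof
    assume "m < n"
    then have "A e j = A (\<lambda>n. 0) j" for j unfolding A e_def by simp
    then have "A e = A (\<lambda>n. 0)" by (rule ext)
    from arg_cong[OF this, of B] have "e = (\<lambda>n. 0)"
      unfolding B(1)[OF e] B(1)[OF ell2_zero(1)] .
    from fun_cong[OF this, of 0] show False by (simp add: e_def)
  qed
  moreover have "\<not> n < m"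
  proof
    assume "n < m"
    then have "A (B e) 0 = 0" by (simp add: A)
    then show False unfolding B(2)[OF e] by (simp add: e_def)
  qed
  ultimately show ?thesis by simp
qed

text \<open>A root \<open>z\<close> contributes the factor \<open>t - z\<close>, written as \<open>t (1 - z / t)\<close> for a root inside the circle
  and as \<open>-z (1 - t / z)\<close> for one outside. Thus \<open>k\<close> is the number of roots inside.\<close>

lemma poly_without_circle_roots_factor:
  fixes P :: "complex poly"
  assumes "P \<noteq> 0" "\<And>t. t \<in> sphere 0 1 \<Longrightarrow> poly P t \<noteq> 0"
  shows "\<exists>k g. neutral_symbol g \<and> (\<forall>t\<in>sphere 0 1. poly P t = t ^ k * g t)"
  using assms
proof (induction "degree P" arbitrary: P)
  case 0
  then obtain c where c: "P = [:c:]" using degree_eq_zeroE by metis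
  then have "neutral_symbol (\<lambda>t. c)" using 0 by (intro neutral_symbol_const) auto
  then show ?case using c by (intro exI[of _ 0] exI[of _ "\<lambda>t. c"]) simp
next
  case (Suc d)
  then have "\<not> constant (poly P)" by (simp add: constant_degree)
  then obtain z where z: "poly P z = 0" using fundamental_theorem_of_algebra by blast
  then obtain Q where Q: "P = [:- z, 1:] * Q" by (metis dvdE poly_eq_0_iff_dvd)
  then have Q0: "Q \<noteq> 0" using Suc.prems by auto
  have "degree P = degree [:- z, 1:] + degree Q"
    unfolding Q by (rule degree_mult_eq) (use Q0 in auto)
  then have "d = degree Q" using Suc.hyps(2) by simp
  moreover have "poly Q t \<noteq> 0" if "t \<in> sphere 0 1" for t
    using Suc.prems(2)[OF that] unfolding Q by simp
  ultimately obtain k g where g: "neutral_symbol g" "\<And>t. t \<in> sphere 0 1 \<Longrightarrow> poly Q t = t ^ k * g t"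
    using Suc.hyps(1) Q0 by metis
  have "cmod z \<noteq> 1" using Suc.prems(2)[of z] z by auto
  show ?case
  proof (cases "cmod z < 1")
    case 1: True
    have "neutral_symbol (\<lambda>t. (1 - z / t) * g t)"
      by (intro neutral_symbol_mult neutral_symbol_antianalytic_factor 1 g)
    moreover have "poly P t = t ^ Suc k * ((1 - z / t) * g t)" if "t \<in> sphere 0 1" for t
      using g(2)[OF that] circle_nonzero[OF that] unfolding Q by (simp add: field_simps)
    ultimately show ?thesis by blast
  next
    case False
    then have "1 < cmod z" using \<open>cmod z \<noteq> 1\<close> by simp
    then have 2: "cmod (1 / z) < 1" "z \<noteq> 0" by (auto simp: norm_divide divide_less_eq_1)
    have "neutral_symbol (\<lambda>t. (- z) * ((1 - (1 / z) * t) * g t))"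
      by (intro neutral_symbol_mult neutral_symbol_const neutral_symbol_analytic_factor 2 g)
        (use 2 in simp)
    moreover have "poly P t = t ^ k * ((- z) * ((1 - (1 / z) * t) * g t))" if "t \<in> sphere 0 1" for t
      using g(2)[OF that] 2(2) unfolding Q by (simp add: field_simps)
    ultimately show ?thesis by blast
  qed
qed

text \<open>Invertibility excludes zeros on the circle. Splitting off the others leaves a power \<open>t\<^sup>\<kappa>\<close>, whose
  operator is a shift, and a shift is invertible for \<open>\<kappa> = 0\<close> only.\<close>

lemma laurent_polynomial_invertible_imp_neutral:
  assumes inv: "invertible_op (toeplitz (\<lambda>t. poly P t / t ^ n))"
  shows "neutral_symbol (\<lambda>t. poly P t / t ^ n)"
proof -
  have P0: "P \<noteq> 0"
  proof
    assume "P = 0"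
    define e where "e = (\<lambda>n::nat. if n = 0 then 1 else 0 :: complex)"
    have e: "e \<in> ell2" unfolding e_def by (rule ell2_unit)
    have eq: "toeplitz (\<lambda>t. poly P t / t ^ n) e = toeplitz (\<lambda>t. poly P t / t ^ n) (\<lambda>n. 0)"
      using toeplitz_const[OF e, of 0] toeplitz_const[OF ell2_zero(1), of 0] \<open>P = 0\<close> by simp
    obtain B where B: "\<And>x. x \<in> ell2 \<Longrightarrow> B (toeplitz (\<lambda>t. poly P t / t ^ n) x) = x"
      by (rule invertible_opE[OF inv]) (rule that)
    from arg_cong[OF eq] have "B (toeplitz (\<lambda>t. poly P t / t ^ n) e) = B (toeplitz (\<lambda>t. poly P t / t ^ n) (\<lambda>n. 0))"
      .
    then have "e = (\<lambda>n. 0)" unfolding B[OF e] B[OF ell2_zero(1)] .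
    from fun_cong[OF this, of 0] show False by (simp add: e_def)
  qed
  have cont: "continuous_on (sphere 0 1) (\<lambda>t. poly Q t / t ^ m)" for Q :: "complex poly" and m
    using circle_nonzero by (intro continuous_intros) auto
  have roots: "poly P \<zeta> \<noteq> 0" if \<zeta>: "\<zeta> \<in> sphere 0 1" for \<zeta>
  proof
    assume "poly P \<zeta> = 0"
    then obtain Q where Q: "P = [:- \<zeta>, 1:] * Q" by (metis dvdE poly_eq_0_iff_dvd)
    have "toeplitz (\<lambda>t. poly P t / t ^ n) = toeplitz (\<lambda>t. (poly (pCons 0 Q) t / t ^ n) * (1 - \<zeta> / t))"
      by (rule toeplitz_cong) (use circle_nonzero in \<open>auto simp: Q field_simps\<close>)
    then show False
      using toeplitz_circle_zero_not_invertible[OF cont \<zeta>] inv by metis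
  qed
  obtain k g where g: "neutral_symbol g" "\<And>t. t \<in> sphere 0 1 \<Longrightarrow> poly P t = t ^ k * g t"
    using poly_without_circle_roots_factor[OF P0 roots] by metis
  have eq: "poly P t / t ^ n = (t ^ k / t ^ n) * g t" if "t \<in> sphere 0 1" for t
    using g(2)[OF that] by simp
  have "toeplitz (\<lambda>t. poly P t / t ^ n) = toeplitz (\<lambda>t. (t ^ k / t ^ n) * g t)"
    by (rule toeplitz_cong) (rule eq)
  moreover have "continuous_on (sphere 0 1) (\<lambda>t::complex. t ^ k / t ^ n)"
    using circle_nonzero by (intro continuous_intros) auto
  ultimately have "invertible_op (toeplitz (\<lambda>t. t ^ k / t ^ n))"
    using inv g(1) unfolding neutral_symbol_def by metis
  then have "k = n" by (rule toeplitz_monomial_invertibleD)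
  then have "poly P t / t ^ n = g t" if "t \<in> sphere 0 1" for t
    using eq[OF that] circle_nonzero[OF that] by simp
  then show ?thesis using g(1) by (rule neutral_symbol_cong)
qed

text \<open>On the circle the conjugate of \<open>t\<close> is \<open>1 / t\<close>, so the coordinates of \<open>t\<close> are Laurent polynomials in \<open>t\<close>.\<close>

lemma real_polynomial_function_on_circle:
  fixes p :: "complex \<Rightarrow> real"
  assumes "real_polynomial_function p"
  shows "\<exists>P n. \<forall>t\<in>sphere 0 1. of_real (p t) = poly P t / t ^ n"
  using assms
proof (induction rule: real_polynomial_function.induct)
  case (linear f)
  interpret bounded_linear f by fact
  have "of_real (f t) = poly [:(f 1 + \<i> * f \<i>) / 2, 0, (f 1 - \<i> * f \<i>) / 2:] t / t ^ 1"
    if t: "t \<in> sphere 0 1" for t :: complex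
  proof -
    have t0: "t \<noteq> 0" using t circle_nonzero by blast
    have "t * cnj t = 1" using t complex_norm_square[of t] by simp
    then have cnj: "cnj t = 1 / t" using t0 by (simp add: field_simps)
    have "t = Re t *\<^sub>R 1 + Im t *\<^sub>R \<i>" by (simp add: complex_eq_iff)
    then have "f t = Re t * f 1 + Im t * f \<i>" by (metis add scaleR real_scaleR_def)
    moreover have "complex_of_real (Re t) = (t + 1 / t) / 2" "complex_of_real (Im t) = - \<i> * (t - 1 / t) / 2"
      unfolding cnj[symmetric] by (simp_all add: complex_eq_iff)
    ultimately have "complex_of_real (f t) = (t + 1 / t) / 2 * f 1 + (- \<i> * (t - 1 / t) / 2) * f \<i>"
      by simp
    moreover have "poly [:(f 1 + \<i> * f \<i>) / 2, 0, (f 1 - \<i> * f \<i>) / 2:] t / t ^ 1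
        = (t + 1 / t) / 2 * f 1 + (- \<i> * (t - 1 / t) / 2) * f \<i>"
      using t0 by (simp add: add_divide_distrib diff_divide_distrib algebra_simps)
    ultimately show ?thesis by simp
  qed
  then show ?case by blast
next
  case (const c)
  show ?case by (intro exI[of _ "[:of_real c:]"] exI[of _ 0]) simp
next
  case (add f g)
  then obtain P n Q m where "\<forall>t\<in>sphere 0 1. of_real (f t) = poly P t / t ^ n"
    "\<forall>t\<in>sphere 0 1. of_real (g t) = poly Q t / t ^ m" by blast
  then have "\<forall>t\<in>sphere 0 1. of_real (f t + g t) = poly (P * monom 1 m + Q * monom 1 n) t / t ^ (n + m)"
    using circle_nonzero by (auto simp: poly_monom field_simps power_add)
  then show ?case by blast
next
  case (mult f g)
  then obtain P n Q m where "\<forall>t\<in>sphere 0 1. of_real (f t) = poly P t / t ^ n"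
    "\<forall>t\<in>sphere 0 1. of_real (g t) = poly Q t / t ^ m" by blast
  then have "\<forall>t\<in>sphere 0 1. of_real (f t * g t) = poly (P * Q) t / t ^ (n + m)"
    by (auto simp: power_add)
  then show ?case by blast
qed

lemma laurent_polynomial_approximation:
  fixes f :: "complex \<Rightarrow> complex"
  assumes f: "continuous_on (sphere 0 1) f" and e: "0 < e"
  obtains P n where "\<And>t. t \<in> sphere 0 1 \<Longrightarrow> cmod (f t - poly P t / t ^ n) < e"
proof -
  obtain p where p: "polynomial_function p" "\<And>t. t \<in> sphere 0 1 \<Longrightarrow> cmod (f t - p t) < e"
    using Stone_Weierstrass_polynomial_function[OF compact_sphere f e] by blast
  have "real_polynomial_function (\<lambda>t. Re (p t))" "real_polynomial_function (\<lambda>t. Im (p t))"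
    using p(1) bounded_linear_Re bounded_linear_Im unfolding polynomial_function_def o_def by blast+
  from this[THEN real_polynomial_function_on_circle] obtain P n Q m where
    "\<And>t. t \<in> sphere 0 1 \<Longrightarrow> of_real (Re (p t)) = poly P t / t ^ n"
    "\<And>t. t \<in> sphere 0 1 \<Longrightarrow> of_real (Im (p t)) = poly Q t / t ^ m" by blast
  then have "p t = poly (P * monom 1 m + smult \<i> (Q * monom 1 n)) t / t ^ (n + m)"
    if "t \<in> sphere 0 1" for t
    using that circle_nonzero[OF that] complex_eq[of "p t"]
    by (simp add: poly_monom field_simps power_add)
  then show thesis using that p(2) by metis
qed

text \<open>This plays the role of the invariance of the winding number in Rouche's theorem. By approximation,
  \<open>f\<close> may be replaced by a Laurent polynomial \<open>q\<close>. It is neutral, so the operators of \<open>g\<close> and \<open>g / q\<close> are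
  invertible together, and \<open>|g / q - 1| < 1\<close>.\<close>

lemma toeplitz_invertible_rouche:
  assumes f: "continuous_on (sphere 0 1) f" and inv: "invertible_op (toeplitz f)"
    and g: "continuous_on (sphere 0 1) g"
    and less: "\<And>t. t \<in> sphere 0 1 \<Longrightarrow> cmod (g t - f t) < cmod (f t)"
  shows "invertible_op (toeplitz g)"
proof -
  obtain \<eta> where \<eta>: "0 < \<eta>"
    "\<And>g. continuous_on (sphere 0 1) g \<Longrightarrow> (\<And>t. t \<in> sphere 0 1 \<Longrightarrow> cmod (g t - f t) \<le> \<eta>)
       \<Longrightarrow> invertible_op (toeplitz g)"
    using toeplitz_invertible_stable[OF f inv] by metis
  have "continuous_on (sphere 0 1) (\<lambda>t. cmod (f t) - cmod (g t - f t))"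
    using f g by (intro continuous_intros)
  moreover have "sphere (0::complex) 1 \<noteq> {}" using cis_in_circle[of 0] by blast
  ultimately obtain s where s: "s \<in> sphere 0 1"
    "\<And>t. t \<in> sphere 0 1 \<Longrightarrow> cmod (f s) - cmod (g s - f s) \<le> cmod (f t) - cmod (g t - f t)"
    using continuous_attains_inf[OF compact_sphere] by blast
  define \<gamma> where "\<gamma> = cmod (f s) - cmod (g s - f s)"
  have \<gamma>: "0 < \<gamma>" using less[OF s(1)] by (simp add: \<gamma>_def)
  obtain P n where P: "\<And>t. t \<in> sphere 0 1 \<Longrightarrow> cmod (f t - poly P t / t ^ n) < min \<eta> (\<gamma> / 2)"
    using laurent_polynomial_approximation[OF f, of "min \<eta> (\<gamma> / 2)"] \<eta>(1) \<gamma> by auto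
  define q where "q t = poly P t / t ^ n" for t
  have q: "continuous_on (sphere 0 1) q"
    unfolding q_def using circle_nonzero by (intro continuous_intros) auto
  have "invertible_op (toeplitz q)"
  proof (rule \<eta>(2)[OF q])
    show "cmod (q t - f t) \<le> \<eta>" if "t \<in> sphere 0 1" for t
      using P[OF that] by (simp add: q_def norm_minus_commute)
  qed
  then have neutral: "neutral_symbol q"
    unfolding q_def[abs_def] by (rule laurent_polynomial_invertible_imp_neutral)
  then have q0: "q t \<noteq> 0" if "t \<in> sphere 0 1" for t
    using that by (simp add: neutral_symbol_def)
  have gq: "continuous_on (sphere 0 1) (\<lambda>t. g t / q t)"
    using q0 by (intro continuous_intros g q) auto
  have "cmod (g t / q t - 1) < 1" if t: "t \<in> sphere 0 1" for t
  proof -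
    have "cmod (f t - q t) < \<gamma> / 2" using P[OF t] by (simp add: q_def)
    moreover have "\<gamma> \<le> cmod (f t) - cmod (g t - f t)" using s(2)[OF t] by (simp add: \<gamma>_def)
    moreover have "cmod (f t) \<le> cmod (f t - q t) + cmod (q t)"
      using norm_triangle_ineq[of "f t - q t" "q t"] by simp
    moreover have "cmod (g t - q t) \<le> cmod (g t - f t) + cmod (f t - q t)"
      using norm_triangle_ineq[of "g t - f t" "f t - q t"] by simp
    ultimately have "cmod (g t - q t) < cmod (q t)" by linarith
    moreover have "g t / q t - 1 = (g t - q t) / q t" using q0[OF t] by (simp add: field_simps)
    ultimately show ?thesis using q0[OF t] by (simp add: norm_divide)
  qed
  then have "invertible_op (toeplitz (\<lambda>t. g t / q t))"
    by (rule toeplitz_invertible_near_one[OF gq])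
  then have "invertible_op (toeplitz (\<lambda>t. g t / q t * q t))"
    using neutral gq by (simp only: neutral_symbol_def)
  moreover have "toeplitz (\<lambda>t. g t / q t * q t) = toeplitz g"
    by (rule toeplitz_cong) (use q0 in auto)
  ultimately show ?thesis by simp
qed

text \<open>Invertibility is stable, so a symbol vanishing at \<open>\<zeta>\<close> could be replaced by a Laurent polynomial
  vanishing there; but an invertible Laurent polynomial is neutral and has no zeros on the circle.\<close>

lemma toeplitz_invertible_imp_nonzero:
  assumes f: "continuous_on (sphere 0 1) f" and inv: "invertible_op (toeplitz f)"
    and \<zeta>: "\<zeta> \<in> sphere 0 1"
  shows "f \<zeta> \<noteq> 0"
proof
  assume zero: "f \<zeta> = 0"
  obtain \<eta> where \<eta>: "0 < \<eta>"
    "\<And>g. continuous_on (sphere 0 1) g \<Longrightarrow> (\<And>t. t \<in> sphere 0 1 \<Longrightarrow> cmod (g t - f t) \<le> \<eta>)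
       \<Longrightarrow> invertible_op (toeplitz g)"
    using toeplitz_invertible_stable[OF f inv] by metis
  obtain P n where P: "\<And>t. t \<in> sphere 0 1 \<Longrightarrow> cmod (f t - poly P t / t ^ n) < \<eta> / 2"
    using laurent_polynomial_approximation[OF f, of "\<eta> / 2"] \<eta>(1) by auto
  \<comment> \<open>Correct the approximation by a constant so that it vanishes at \<open>\<zeta>\<close> as well.\<close>
  define Q where "Q = P - smult (poly P \<zeta> / \<zeta> ^ n) (monom 1 n)"
  have Q: "poly Q t / t ^ n = poly P t / t ^ n - poly P \<zeta> / \<zeta> ^ n" if "t \<in> sphere 0 1" for t
    using circle_nonzero[OF that] by (simp add: Q_def poly_monom field_simps)
  have "invertible_op (toeplitz (\<lambda>t. poly Q t / t ^ n))"
  proof (rule \<eta>(2))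
    show "continuous_on (sphere 0 1) (\<lambda>t. poly Q t / t ^ n)"
      using circle_nonzero by (intro continuous_intros) auto
    show "cmod (poly Q t / t ^ n - f t) \<le> \<eta>" if "t \<in> sphere 0 1" for t
      using P[OF that] P[OF \<zeta>] norm_triangle_ineq4[of "poly P t / t ^ n - f t" "poly P \<zeta> / \<zeta> ^ n"] zero
      unfolding Q[OF that] by (simp add: norm_minus_commute algebra_simps)
  qed
  from laurent_polynomial_invertible_imp_neutral[OF this] show False
    using Q[OF \<zeta>] \<zeta> by (auto simp: neutral_symbol_def)
qed

section \<open>Partitions and the discretization error\<close>

lemma is_partition_nth:
  assumes "is_partition \<alpha> \<beta> xs"
  shows "xs \<noteq> []" "xs ! 0 = \<alpha>" "xs ! (length xs - 1) = \<beta>"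
    and "\<And>i j. i < j \<Longrightarrow> j < length xs \<Longrightarrow> xs ! i < xs ! j"
    and "\<And>i j. i \<le> j \<Longrightarrow> j < length xs \<Longrightarrow> xs ! i \<le> xs ! j"
proof -
  show "xs \<noteq> []" "xs ! 0 = \<alpha>" "xs ! (length xs - 1) = \<beta>"
    using assms by (auto simp: is_partition_def hd_conv_nth last_conv_nth)
  show less: "xs ! i < xs ! j" if "i < j" "j < length xs" for i j
    using assms that by (auto simp: is_partition_def sorted_wrt_iff_nth_less)
  show "xs ! i \<le> xs ! j" if "i \<le> j" "j < length xs" for i j
    using less[of i j] that by (cases "i = j") auto
qed

lemma partition_subset:
  assumes "is_partition \<alpha> \<beta> xs"
  shows "set xs \<subseteq> {\<alpha>..\<beta>}"
proof
  fix x assume "x \<in> set xs"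
  then obtain i where i: "i < length xs" "x = xs ! i" by (auto simp: in_set_conv_nth)
  then show "x \<in> {\<alpha>..\<beta>}"
    using is_partition_nth(5)[OF assms, of 0 i] is_partition_nth(5)[OF assms, of i "length xs - 1"]
      is_partition_nth(2,3)[OF assms] by simp
qed

lemma partition_segment:
  assumes "is_partition \<alpha> \<beta> xs" "\<alpha> \<le> v" "v < \<beta>"
  obtains j where "j + 1 < length xs" "xs ! j \<le> v" "v < xs ! (j + 1)"
proof -
  have "\<exists>k<length xs - 1. (\<forall>i\<le>k. \<not> v < xs ! i) \<and> v < xs ! Suc k"
    by (rule ex_least_nat_less) (use assms is_partition_nth[OF assms(1)] in auto)
  then obtain k where "k < length xs - 1" "\<not> v < xs ! k" "v < xs ! Suc k" by blast
  then show thesis using that[of k] by simp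
qed

lemma finite_gaps: "finite {xs ! (j + 1) - xs ! j | j. j + 1 < length (xs :: real list)}"
  by (rule finite_subset[of _ "(\<lambda>j. xs ! (j + 1) - xs ! j) ` {..<length xs}"]) auto

lemma gap_le_granularity:
  assumes "j + 1 < length xs"
  shows "xs ! (j + 1) - xs ! j \<le> granularity xs"
  unfolding granularity_def by (rule Max_ge) (use finite_gaps assms in auto)

lemma granularity_nonneg: "0 \<le> granularity xs"
  unfolding granularity_def by (rule Max_ge) (use finite_gaps in auto)

lemma granularity_leI:
  assumes "0 \<le> \<Delta>" "\<And>j. j + 1 < length xs \<Longrightarrow> xs ! (j + 1) - xs ! j \<le> \<Delta>"
  shows "granularity xs \<le> \<Delta>"
  unfolding granularity_def by (rule Max.boundedI) (use finite_gaps assms in auto)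

lemma partition_point_near:
  assumes xs: "xs \<in> partitions \<alpha> \<beta> \<Delta>" and \<rho>: "\<rho> \<in> {\<alpha>..\<beta>}"
  obtains x where "x \<in> set xs" "\<bar>x - \<rho>\<bar> \<le> \<Delta>"
proof (cases "\<rho> = \<beta>")
  case True
  have "\<beta> \<in> set xs" using xs by (auto simp: partitions_def is_partition_def)
  then show thesis
    using that[of \<beta>] True xs granularity_nonneg[of xs] by (simp add: partitions_def)
next
  case False
  have part: "is_partition \<alpha> \<beta> xs" and gran: "granularity xs \<le> \<Delta>"
    using xs by (auto simp: partitions_def)
  obtain j where j: "j + 1 < length xs" "xs ! j \<le> \<rho>" "\<rho> < xs ! (j + 1)"
    using partition_segment[OF part, of \<rho>] \<rho> False by auto
  then show thesis
    using that[of "xs ! j"] gap_le_granularity[OF j(1)] gran by simp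
qed

lemma partitions_nonempty:
  assumes "\<alpha> \<le> \<beta>" "0 < \<Delta>"
  shows "partitions \<alpha> \<beta> \<Delta> \<noteq> {}"
proof (cases "\<alpha> = \<beta>")
  case True
  then have "[\<alpha>] \<in> partitions \<alpha> \<beta> \<Delta>"
    using granularity_leI[of \<Delta> "[\<alpha>]"] assms(2) by (simp add: partitions_def is_partition_def)
  then show ?thesis by blast
next
  case False
  then have less: "0 < \<beta> - \<alpha>" using assms(1) by simp
  obtain N where N: "(\<beta> - \<alpha>) / \<Delta> < real N" using reals_Archimedean2 by blast
  then have N0: "0 < N" using less assms(2) by (cases N) (auto simp: divide_less_0_iff)
  define xs where "xs = map (\<lambda>i. \<alpha> + (\<beta> - \<alpha>) * real i / real N) [0..<Suc N]"
  have len: "length xs = Suc N" and nth: "\<And>i. i \<le> N \<Longrightarrow> xs ! i = \<alpha> + (\<beta> - \<alpha>) * real i / real N"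
    by (auto simp: xs_def simp del: upt_Suc)
  have "xs \<noteq> []" using len by auto
  moreover have "hd xs = \<alpha>" using \<open>xs \<noteq> []\<close> nth[of 0] by (simp add: hd_conv_nth)
  moreover have "last xs = \<beta>" using \<open>xs \<noteq> []\<close> nth[of N] N0 len by (simp add: last_conv_nth)
  moreover have "sorted_wrt (<) xs"
    unfolding sorted_wrt_iff_nth_less using len nth less N0
    by (auto intro!: divide_strict_right_mono mult_strict_left_mono)
  moreover have "granularity xs \<le> \<Delta>"
  proof (rule granularity_leI)
    fix j assume "j + 1 < length xs"
    then have "xs ! (j + 1) - xs ! j = (\<beta> - \<alpha>) / real N"
      using nth[of j] nth[of "j + 1"] len by (simp add: diff_divide_distrib[symmetric] algebra_simps)
    also have "\<dots> \<le> \<Delta>" using N N0 assms(2) by (simp add: field_simps)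
    finally show "xs ! (j + 1) - xs ! j \<le> \<Delta>" .
  qed (use assms in simp)
  ultimately have "xs \<in> partitions \<alpha> \<beta> \<Delta>" by (simp add: partitions_def is_partition_def)
  then show ?thesis by blast
qed

lemma polygon_closed_segment:
  assumes part: "is_partition 0 (2 * pi) vs" and j: "j + 1 < length vs"
    and v: "vs ! j \<le> v" "v \<le> vs ! (j + 1)"
  shows "polygon vs a (cis v) = of_real ((v - vs ! j) / (vs ! (j + 1) - vs ! j)) *
             (a (cis (vs ! (j + 1))) - a (cis (vs ! j))) + a (cis (vs ! j))"
proof (cases "v < vs ! (j + 1)")
  case True
  then show ?thesis using polygon_cis[OF part j v(1)] by simp
next
  case False
  then have v: "v = vs ! (j + 1)" using v by simp
  have gap: "vs ! i < vs ! (i + 1)" if "i + 1 < length vs" for i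
    using is_partition_nth(4)[OF part, of i "i + 1"] that by simp
  have "polygon vs a (cis v) = a (cis v)"
  proof (cases "j + 2 < length vs")
    case True
    then show ?thesis
      using polygon_cis[OF part, of "j + 1" v a] gap[of "j + 1"] v by simp
  next
    case False
    \<comment> \<open>The last vertex \<open>2\<pi>\<close> is the first vertex \<open>0\<close> again.\<close>
    then have "length vs - 1 = j + 1" using j by simp
    then have "cis v = cis 0" using is_partition_nth(3)[OF part] v by simp
    moreover have "polygon vs a (cis 0) = a (cis 0)"
      using polygon_cis[OF part, of 0 0 a] gap[of 0] is_partition_nth(2)[OF part] j by simp
    ultimately show ?thesis by simp
  qed
  then show ?thesis using gap[OF j] v by simp
qed

lemma continuous_on_polygon:
  assumes part: "is_partition 0 (2 * pi) vs"
  shows "continuous_on (sphere 0 1) (polygon vs a)"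
proof -
  let ?U = "\<lambda>j. {vs ! j..vs ! (j + 1)}"
  have pieces: "continuous_on (?U j) (\<lambda>v. polygon vs a (cis v))" if "j \<in> {..<length vs - 1}" for j
  proof -
    have j: "j + 1 < length vs" using that by simp
    have "vs ! j \<noteq> vs ! (j + 1)" using is_partition_nth(4)[OF part, of j "j + 1"] j by simp
    then have "continuous_on (?U j) (\<lambda>v. of_real ((v - vs ! j) / (vs ! (j + 1) - vs ! j)) *
             (a (cis (vs ! (j + 1))) - a (cis (vs ! j))) + a (cis (vs ! j)))"
      by (intro continuous_intros) auto
    then show ?thesis
      by (rule continuous_on_eq) (use polygon_closed_segment[OF part j] in simp)
  qed
  have "continuous_on (\<Union>j\<in>{..<length vs - 1}. ?U j) (\<lambda>v. polygon vs a (cis v))"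
    by (rule continuous_on_closed_Union) (use pieces in auto)
  moreover have "{0..2*pi} \<subseteq> (\<Union>j\<in>{..<length vs - 1}. ?U j)"
  proof
    fix v assume v: "v \<in> {0..2*pi}"
    show "v \<in> (\<Union>j\<in>{..<length vs - 1}. ?U j)"
    proof (cases "v = 2 * pi")
      case True
      have "length vs \<noteq> 1"
        using is_partition_nth(2,3)[OF part] by auto
      then have "length vs - 2 + 1 < length vs" "length vs - 2 + 1 = length vs - 1"
        using is_partition_nth(1)[OF part] by (cases vs; auto)+
      then show ?thesis
        using True is_partition_nth(3)[OF part] is_partition_nth(5)[OF part, of "length vs - 2" "length vs - 1"]
        by (intro UN_I[of "length vs - 2"]) auto
    next
      case False
      then obtain j where "j + 1 < length vs" "vs ! j \<le> v" "v < vs ! (j + 1)"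
        using partition_segment[OF part, of v] v by auto
      then show ?thesis by (intro UN_I[of j]) auto
    qed
  qed
  ultimately have cont: "continuous_on {0..2*pi} (\<lambda>v. polygon vs a (cis v))"
    by (rule continuous_on_subset)
  \<comment> \<open>The circle is a quotient of \<open>[0, 2\<pi>]\<close>, the parametrization being a closed map.\<close>
  have "closed (polygon vs a -` B \<inter> sphere 0 1)" if B: "closed B" for B
  proof -
    have "closed ((\<lambda>v. polygon vs a (cis v)) -` B \<inter> {0..2*pi})"
      using cont B by (subst (asm) continuous_on_closed_vimage) auto
    then have "compact ((\<lambda>v. polygon vs a (cis v)) -` B \<inter> {0..2*pi})"
      using compact_Int_closed[OF compact_Icc[of 0 "2*pi"]] by (metis inf_commute inf_left_idem)
    then have "compact (cis ` ((\<lambda>v. polygon vs a (cis v)) -` B \<inter> {0..2*pi}))"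
      by (intro compact_continuous_image continuous_intros)
    moreover have "cis ` ((\<lambda>v. polygon vs a (cis v)) -` B \<inter> {0..2*pi}) = polygon vs a -` B \<inter> sphere 0 1"
    proof (intro equalityI subsetI)
      fix t assume t: "t \<in> polygon vs a -` B \<inter> sphere 0 1"
      then obtain v where "t = cis v" "0 \<le> v" "v < 2 * pi" using circle_cases by blast
      with t show "t \<in> cis ` ((\<lambda>v. polygon vs a (cis v)) -` B \<inter> {0..2*pi})" by auto
    qed auto
    ultimately show ?thesis using compact_imp_closed by metis
  qed
  then show ?thesis by (subst continuous_on_closed_vimage) auto
qed

text \<open>\<open>D\<close> stands for the derivative of \<open>v \<mapsto> a (cis v)\<close>. The Taylor estimate at the left vertex of a segment
  applies both at \<open>v\<close> and at the right vertex, whence the factor 2; the linear interpolation reproduces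
  the first-order part exactly.\<close>

lemma polygon_error:
  assumes vs: "vs \<in> partitions 0 (2 * pi) \<Delta>" and t: "t \<in> sphere 0 1" and L: "0 \<le> L"
    and taylor: "\<And>u v. cmod (a (cis v) - a (cis u) - of_real (v - u) * D u) \<le> L * (v - u)\<^sup>2"
  shows "cmod (polygon vs a t - a t) \<le> 2 * L * \<Delta>\<^sup>2"
proof -
  have part: "is_partition 0 (2 * pi) vs" and gran: "granularity vs \<le> \<Delta>"
    using vs by (auto simp: partitions_def)
  obtain v where v: "t = cis v" "0 \<le> v" "v < 2 * pi" using circle_cases[OF t] by blast
  obtain j where j: "j + 1 < length vs" "vs ! j \<le> v" "v < vs ! (j + 1)"
    using partition_segment[OF part v(2,3)] by blast
  define x y where "x = vs ! j" and "y = vs ! (j + 1)"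
  have xy: "x \<le> v" "v < y" "y - x \<le> \<Delta>"
    using j gap_le_granularity[OF j(1)] gran by (auto simp: x_def y_def)
  define \<theta> where "\<theta> = (v - x) / (y - x)"
  have \<theta>: "0 \<le> \<theta>" "\<theta> \<le> 1" "\<theta> * (y - x) = v - x" using xy by (auto simp: \<theta>_def divide_simps)
  define R where "R u = a (cis u) - a (cis x) - of_real (u - x) * D x" for u
  have R: "cmod (R u) \<le> L * \<Delta>\<^sup>2" if "x \<le> u" "u \<le> y" for u
  proof -
    have "cmod (R u) \<le> L * (u - x)\<^sup>2" unfolding R_def by (rule taylor)
    also have "\<dots> \<le> L * \<Delta>\<^sup>2" using that xy L by (intro mult_left_mono power_mono) auto
    finally show ?thesis .
  qed
  have lin: "of_real \<theta> * (of_real (y - x) * D x) = of_real (v - x) * D x"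
    unfolding \<theta>(3)[symmetric] by simp
  have "polygon vs a t - a t = of_real \<theta> * (a (cis y) - a (cis x)) + a (cis x) - a (cis v)"
    using polygon_cis[OF part j(1,2,3), of a] by (simp add: v(1) \<theta>_def x_def y_def)
  also have "\<dots> = of_real \<theta> * R y - R v"
    using lin by (simp add: R_def algebra_simps)
  finally have "cmod (polygon vs a t - a t) \<le> cmod (of_real \<theta> * R y) + cmod (R v)"
    by (simp add: norm_triangle_ineq4)
  also have "cmod (of_real \<theta> * R y) \<le> 1 * (L * \<Delta>\<^sup>2)"
    unfolding norm_mult norm_of_real by (intro mult_mono R) (use \<theta> xy in auto)
  also have "cmod (R v) \<le> L * \<Delta>\<^sup>2" by (rule R) (use xy in auto)
  finally show ?thesis by simp
qed

lemma cis_taylor_bound: "cmod (cis x - 1 - \<i> * of_real x) \<le> x\<^sup>2"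
proof -
  have "cmod (exp (\<i> * of_real x) - (\<Sum>k\<le>1. (\<i> * of_real x) ^ k / fact k)) \<le> x\<^sup>2"
    using Taylor_exp[of "\<i> * of_real x" 1] by (simp add: norm_mult power2_eq_square)
  then show ?thesis by (simp add: cis_conv_exp algebra_simps)
qed

text \<open>A bound for the second derivative of \<open>v \<mapsto> b (\<rho> cis v)\<close>.\<close>

definition curvature_bound :: "nat \<Rightarrow> nat \<Rightarrow> (int \<Rightarrow> complex) \<Rightarrow> real \<Rightarrow> real" where
  "curvature_bound r s b \<rho> = (\<Sum>n\<in>{- int r..int s}. cmod (b n) * \<rho> powi n * (of_int n)\<^sup>2)"

lemma polygon_error_laurent:
  assumes \<rho>: "0 < \<rho>" and vs: "vs \<in> partitions 0 (2 * pi) \<Delta>" and t: "t \<in> sphere 0 1"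
  shows "cmod (polygon vs (dilate \<rho> (laurent r s b)) t - dilate \<rho> (laurent r s b) t)
           \<le> 2 * curvature_bound r s b \<rho> * \<Delta>\<^sup>2"
proof (rule polygon_error[OF vs t])
  let ?N = "{- int r..int s}"
  show "0 \<le> curvature_bound r s b \<rho>"
    unfolding curvature_bound_def using \<rho> by (intro sum_nonneg mult_nonneg_nonneg) auto
  define c where "c n = b n * of_real \<rho> powi n" for n
  have cis_powi: "cis v powi n = cis (of_int n * v)" for v n
    using Complex.DeMoivre[of v "nat n"] Complex.DeMoivre[of "- v" "nat (- n)"]
    by (auto simp: power_int_def cis_inverse)
  have val: "dilate \<rho> (laurent r s b) (cis v) = (\<Sum>n\<in>?N. c n * cis (of_int n * v))" for v
    by (simp add: dilate_def laurent_def c_def power_int_mult_distrib cis_powi mult.assoc)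
  fix u v :: real
  let ?D = "\<lambda>u. \<Sum>n\<in>?N. c n * (\<i> * of_int n * cis (of_int n * u))"
  have "dilate \<rho> (laurent r s b) (cis v) - dilate \<rho> (laurent r s b) (cis u) - of_real (v - u) * ?D u
      = (\<Sum>n\<in>?N. c n * cis (of_int n * u) * (cis (of_int n * (v - u)) - 1 - \<i> * of_real (of_int n * (v - u))))"
  proof -
    have "cis (of_int n * v) = cis (of_int n * u) * cis (of_int n * (v - u))" for n
      unfolding cis_mult by (simp add: algebra_simps)
    then show ?thesis
      unfolding val sum_distrib_left sum_subtractf[symmetric]
      by (intro sum.cong) (auto simp: algebra_simps)
  qed
  also have "cmod \<dots> \<le> (\<Sum>n\<in>?N. cmod (b n) * \<rho> powi n * (of_int n * (v - u))\<^sup>2)"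
  proof (rule sum_norm_le)
    fix n
    have "cmod (c n) = cmod (b n) * \<rho> powi n"
      using \<rho> by (simp add: c_def norm_mult norm_power_int)
    then show "cmod (c n * cis (of_int n * u) * (cis (of_int n * (v - u)) - 1 - \<i> * of_real (of_int n * (v - u))))
        \<le> cmod (b n) * \<rho> powi n * (of_int n * (v - u))\<^sup>2"
      using cis_taylor_bound[of "of_int n * (v - u)"] \<rho>
      unfolding norm_mult norm_cis by (simp only: mult_1_right) (intro mult_left_mono, auto)
  qed
  also have "\<dots> = curvature_bound r s b \<rho> * (v - u)\<^sup>2"
    by (simp add: curvature_bound_def sum_distrib_right power_mult_distrib mult.assoc)
  finally show "cmod (dilate \<rho> (laurent r s b) (cis v) - dilate \<rho> (laurent r s b) (cis u)
      - of_real (v - u) * ?D u) \<le> curvature_bound r s b \<rho> * (v - u)\<^sup>2" .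
qed

section \<open>Spectra of Toeplitz operators under perturbation of the symbol\<close>

lemma sp_toeplitz_bounded:
  assumes a: "continuous_on (sphere 0 1) a" and M: "\<And>t. t \<in> sphere 0 1 \<Longrightarrow> cmod (a t) \<le> M"
    and \<mu>: "\<mu> \<in> sp_toeplitz a"
  shows "cmod \<mu> \<le> M"
proof (rule ccontr)
  assume "\<not> cmod \<mu> \<le> M"
  then have big: "M < cmod \<mu>" by simp
  have "0 \<le> M" using M[of 1] by (auto intro: order_trans[OF norm_ge_zero])
  then have "\<mu> \<noteq> 0" using big by auto
  then have "invertible_op (toeplitz (\<lambda>t. - \<mu>))"
    by (intro neutral_symbol_invertible neutral_symbol_const) simp
  then have "invertible_op (toeplitz (\<lambda>t. a t - \<mu>))"
  proof (rule toeplitz_invertible_rouche[OF continuous_on_const])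
    show "continuous_on (sphere 0 1) (\<lambda>t. a t - \<mu>)" using a by (intro continuous_intros)
    show "cmod (a t - \<mu> - - \<mu>) < cmod (- \<mu>)" if "t \<in> sphere 0 1" for t
      using M[OF that] big by simp
  qed
  then show False using \<mu> sp_toeplitz_iff[OF a] by blast
qed

text \<open>Spectra of non-normal operators can in general shrink abruptly under a small perturbation. Those of
  Toeplitz operators with continuous symbols cannot: if the disc of radius \<open>\<delta>\<close> about \<open>\<mu>\<close> misses the
  spectrum for \<open>g\<close>, it misses the values of \<open>g\<close>, so \<open>|f - g| \<le> \<delta> < |g - \<mu>|\<close> on the circle and
  invertibility passes from \<open>g - \<mu>\<close> to \<open>f - \<mu>\<close>.\<close>

lemma sp_toeplitz_subset_fattening:
  assumes f: "continuous_on (sphere 0 1) f" and g: "continuous_on (sphere 0 1) g"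
    and \<delta>: "0 \<le> \<delta>" and le: "\<And>t. t \<in> sphere 0 1 \<Longrightarrow> cmod (g t - f t) \<le> \<delta>"
  shows "sp_toeplitz f \<subseteq> fattening \<delta> (sp_toeplitz g)"
proof
  fix \<mu> assume \<mu>: "\<mu> \<in> sp_toeplitz f"
  show "\<mu> \<in> fattening \<delta> (sp_toeplitz g)"
  proof (rule ccontr)
    assume "\<mu> \<notin> fattening \<delta> (sp_toeplitz g)"
    then have inv: "invertible_op (toeplitz (\<lambda>t. g t - \<nu>))" if "cmod (\<nu> - \<mu>) \<le> \<delta>" for \<nu>
      using that sp_toeplitz_iff[OF g, of \<nu>] by (auto simp: fattening_def dist_norm norm_minus_commute)
    have far: "\<delta> < cmod (g t - \<mu>)" if t: "t \<in> sphere 0 1" for t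
    proof (rule ccontr)
      assume "\<not> \<delta> < cmod (g t - \<mu>)"
      then have "invertible_op (toeplitz (\<lambda>s. g s - g t))" by (intro inv) simp
      moreover have "continuous_on (sphere 0 1) (\<lambda>s. g s - g t)" using g by (intro continuous_intros)
      ultimately show False using toeplitz_invertible_imp_nonzero[OF _ _ t] by fastforce
    qed
    have "invertible_op (toeplitz (\<lambda>t. f t - \<mu>))"
    proof (rule toeplitz_invertible_rouche)
      show "continuous_on (sphere 0 1) (\<lambda>t. g t - \<mu>)" "continuous_on (sphere 0 1) (\<lambda>t. f t - \<mu>)"
        by (intro continuous_intros f g)+
      show "invertible_op (toeplitz (\<lambda>t. g t - \<mu>))" using inv \<delta> by simp
      show "cmod (f t - \<mu> - (g t - \<mu>)) < cmod (g t - \<mu>)" if "t \<in> sphere 0 1" for t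
        using le[OF that] far[OF that] by (simp add: norm_minus_commute)
    qed
    then show False using \<mu> sp_toeplitz_iff[OF f] by blast
  qed
qed

section \<open>Dilations over a compact range of radii\<close>

lemma continuous_on_laurent: "continuous_on (- {0}) (laurent r s b)"
  unfolding laurent_def[abs_def] by (intro continuous_intros) auto

lemma continuous_on_dilate_laurent:
  assumes "0 < \<rho>"
  shows "continuous_on (sphere 0 1) (dilate \<rho> (laurent r s b))"
  unfolding dilate_def[abs_def]
  by (rule continuous_on_compose2[OF continuous_on_laurent]) (use assms in \<open>auto intro!: continuous_intros\<close>)

lemma compact_annulus: "compact {z::complex. \<rho>l \<le> cmod z \<and> cmod z \<le> \<rho>h}"
proof -
  have "{z::complex. \<rho>l \<le> cmod z \<and> cmod z \<le> \<rho>h} = cball 0 \<rho>h - ball 0 \<rho>l" by auto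
  then show ?thesis by (simp add: compact_diff)
qed

lemma continuous_on_annulus_laurent:
  assumes "0 < \<rho>l"
  shows "continuous_on {z. \<rho>l \<le> cmod z \<and> cmod z \<le> \<rho>h} (laurent r s b)"
  by (rule continuous_on_subset[OF continuous_on_laurent]) (use assms in auto)

lemma dilate_laurent_bounded:
  assumes "0 < \<rho>l"
  obtains M where "\<And>\<rho> t. \<rho> \<in> {\<rho>l..\<rho>h} \<Longrightarrow> t \<in> sphere 0 1 \<Longrightarrow> cmod (dilate \<rho> (laurent r s b) t) \<le> M"
proof -
  have "bounded (laurent r s b ` {z. \<rho>l \<le> cmod z \<and> cmod z \<le> \<rho>h})"
    by (intro compact_imp_bounded compact_continuous_image continuous_on_annulus_laurent
        compact_annulus assms)
  then obtain M where M: "\<And>z. \<rho>l \<le> cmod z \<Longrightarrow> cmod z \<le> \<rho>h \<Longrightarrow> cmod (laurent r s b z) \<le> M"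
    unfolding bounded_iff by auto
  show thesis
  proof
    fix \<rho> t assume "\<rho> \<in> {\<rho>l..\<rho>h}" "t \<in> sphere (0::complex) 1"
    then show "cmod (dilate \<rho> (laurent r s b) t) \<le> M"
      unfolding dilate_def using assms by (intro M) (auto simp: norm_mult)
  qed
qed

lemma dilate_laurent_equicontinuous:
  assumes "0 < \<rho>l" "0 < \<eta>"
  obtains d where "0 < d" "\<And>\<rho> \<rho>' t. \<rho> \<in> {\<rho>l..\<rho>h} \<Longrightarrow> \<rho>' \<in> {\<rho>l..\<rho>h} \<Longrightarrow> \<bar>\<rho>' - \<rho>\<bar> < d \<Longrightarrow>
    t \<in> sphere 0 1 \<Longrightarrow> cmod (dilate \<rho>' (laurent r s b) t - dilate \<rho> (laurent r s b) t) < \<eta>"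
proof -
  have "uniformly_continuous_on {z. \<rho>l \<le> cmod z \<and> cmod z \<le> \<rho>h} (laurent r s b)"
    by (intro compact_uniformly_continuous continuous_on_annulus_laurent compact_annulus assms)
  then obtain d where d: "0 < d" "\<And>z w. \<rho>l \<le> cmod z \<Longrightarrow> cmod z \<le> \<rho>h \<Longrightarrow> \<rho>l \<le> cmod w \<Longrightarrow> cmod w \<le> \<rho>h
      \<Longrightarrow> dist w z < d \<Longrightarrow> dist (laurent r s b w) (laurent r s b z) < \<eta>"
    using assms(2) unfolding uniformly_continuous_on_def by blast
  show thesis
  proof (rule that[OF d(1)])
    fix \<rho> \<rho>' t
    assume *: "\<rho> \<in> {\<rho>l..\<rho>h}" "\<rho>' \<in> {\<rho>l..\<rho>h}" "\<bar>\<rho>' - \<rho>\<bar> < d" "t \<in> sphere (0::complex) 1"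
    have "dist (of_real \<rho>' * t) (of_real \<rho> * t) = cmod (of_real (\<rho>' - \<rho>) * t)"
      by (simp add: dist_norm left_diff_distrib)
    also have "\<dots> = \<bar>\<rho>' - \<rho>\<bar>" using *(4) unfolding norm_mult norm_of_real by simp
    finally have "dist (laurent r s b (of_real \<rho>' * t)) (laurent r s b (of_real \<rho> * t)) < \<eta>"
      using * assms(1) by (intro d(2)) (auto simp: norm_mult)
    then show "cmod (dilate \<rho>' (laurent r s b) t - dilate \<rho> (laurent r s b) t) < \<eta>"
      by (simp add: dilate_def dist_norm)
  qed
qed

lemma curvature_bound_bounded:
  assumes "0 < \<rho>l"
  obtains L where "0 \<le> L" "\<And>\<rho>. \<rho> \<in> {\<rho>l..\<rho>h} \<Longrightarrow> curvature_bound r s b \<rho> \<le> L"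
proof -
  have "continuous_on {\<rho>l..\<rho>h} (curvature_bound r s b)"
    unfolding curvature_bound_def[abs_def] using assms by (intro continuous_intros) auto
  then have "bounded (curvature_bound r s b ` {\<rho>l..\<rho>h})"
    by (intro compact_imp_bounded compact_continuous_image compact_Icc)
  then obtain L where "0 < L" "\<And>\<rho>. \<rho> \<in> {\<rho>l..\<rho>h} \<Longrightarrow> \<bar>curvature_bound r s b \<rho>\<bar> \<le> L"
    unfolding bounded_pos by auto
  then show thesis using that[of L] by fastforce
qed

section \<open>Approximation of the limit set\<close>

lemma hausdorff_dist_nonneg: "0 \<le> hausdorff_dist A B"
  unfolding hausdorff_dist_def by (rule Inf_greatest) auto

lemma hausdorff_dist_le_if_superset:
  assumes "0 \<le> \<epsilon>" "B \<subseteq> A" "A \<subseteq> fattening \<epsilon> B"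
  shows "hausdorff_dist A B \<le> ereal \<epsilon>"
proof -
  have "B \<subseteq> fattening \<epsilon> A"
  proof
    fix x assume "x \<in> B"
    then show "x \<in> fattening \<epsilon> A"
      unfolding fattening_def using assms(1,2) by (intro UN_I[of x]) auto
  qed
  then show ?thesis
    unfolding hausdorff_dist_def using assms by (intro Inf_lower) auto
qed

text \<open>Invertibility is an open condition jointly in the spectral parameter, the radius and the symbol, so a
  point \<open>z\<close> excluded by some radius \<open>\<rho>\<close> has a neighbourhood excluded by all radii near \<open>\<rho>\<close> and all fine polygons.\<close>

lemma locally_excluded:
  assumes \<rho>l: "0 < \<rho>l" and \<rho>: "\<rho> \<in> {\<rho>l..\<rho>h}" and C: "0 \<le> C"
    and err: "\<And>\<rho> vs \<Delta> t. \<rho> \<in> {\<rho>l..\<rho>h} \<Longrightarrow> vs \<in> partitions 0 (2 * pi) \<Delta> \<Longrightarrow> t \<in> sphere 0 1 \<Longrightarrow>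
      cmod (polygon vs (dilate \<rho> (laurent r s b)) t - dilate \<rho> (laurent r s b) t) \<le> C * \<Delta>\<^sup>2"
    and z: "z \<notin> sp_toeplitz (dilate \<rho> (laurent r s b))"
  obtains d where "0 < d" "\<And>z' \<rho>s vs \<Delta>\<rho> \<Delta>v. z' \<in> ball z d \<Longrightarrow> \<Delta>\<rho> < d \<Longrightarrow> 0 < \<Delta>v \<Longrightarrow> \<Delta>v < d \<Longrightarrow>
    \<rho>s \<in> partitions \<rho>l \<rho>h \<Delta>\<rho> \<Longrightarrow> vs \<in> partitions 0 (2 * pi) \<Delta>v \<Longrightarrow>
    z' \<notin> (\<Inter>\<rho>\<in>set \<rho>s. fattening (C * \<Delta>v\<^sup>2) (sp_toeplitz (polygon vs (dilate \<rho> (laurent r s b)))))"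
proof -
  let ?a = "\<lambda>\<rho>. dilate \<rho> (laurent r s b)"
  have cont: "continuous_on (sphere 0 1) (?a \<rho>)" using \<rho> \<rho>l by (intro continuous_on_dilate_laurent) simp
  have "invertible_op (toeplitz (\<lambda>t. ?a \<rho> t - z))" using z sp_toeplitz_iff[OF cont] by blast
  moreover have "continuous_on (sphere 0 1) (\<lambda>t. ?a \<rho> t - z)" using cont by (intro continuous_intros)
  ultimately obtain \<eta> where \<eta>: "0 < \<eta>"
    "\<And>g. continuous_on (sphere 0 1) g \<Longrightarrow> (\<And>t. t \<in> sphere 0 1 \<Longrightarrow> cmod (g t - (?a \<rho> t - z)) \<le> \<eta>)
       \<Longrightarrow> invertible_op (toeplitz g)"
    using toeplitz_invertible_stable by metis
  obtain d0 where d0: "0 < d0" "\<And>\<rho>1 \<rho>' t. \<rho>1 \<in> {\<rho>l..\<rho>h} \<Longrightarrow> \<rho>' \<in> {\<rho>l..\<rho>h} \<Longrightarrow> \<bar>\<rho>' - \<rho>1\<bar> < d0 \<Longrightarrow>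
      t \<in> sphere 0 1 \<Longrightarrow> cmod (?a \<rho>' t - ?a \<rho>1 t) < \<eta> / 4"
    by (rule dilate_laurent_equicontinuous[OF \<rho>l, of "\<eta> / 4" \<rho>h r s b])
      (use \<eta>(1) in simp, rule that)
  \<comment> \<open>Four errors of size \<open>\<eta> / 4\<close>: fattening, discretization, change of radius, change of \<open>z\<close>.\<close>
  define d where "d = Min {1, d0, \<eta> / 4, \<eta> / (4 * (C + 1))}"
  have d: "0 < d" "d \<le> 1" "d \<le> d0" "d \<le> \<eta> / 4" "d \<le> \<eta> / (4 * (C + 1))"
  proof -
    show "0 < d" using d0(1) \<eta>(1) C by (simp add: d_def)
    show "d \<le> 1" "d \<le> d0" "d \<le> \<eta> / 4" "d \<le> \<eta> / (4 * (C + 1))"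
      unfolding d_def by (rule Min_le; simp)+
  qed
  have small: "C * \<Delta>\<^sup>2 \<le> \<eta> / 4" if "0 < \<Delta>" "\<Delta> < d" for \<Delta>
  proof -
    have "\<Delta>\<^sup>2 \<le> \<Delta> * 1" unfolding power2_eq_square using that d by (intro mult_left_mono) auto
    then have "C * \<Delta>\<^sup>2 \<le> (C + 1) * d"
      using that C d(1) by (intro mult_mono) auto
    also have "\<dots> \<le> (C + 1) * (\<eta> / (4 * (C + 1)))" using d(5) C by (intro mult_left_mono) auto
    also have "\<dots> = \<eta> / 4" using C by (simp add: field_simps)
    finally show ?thesis .
  qed
  show thesis
  proof (rule that[OF d(1)], rule notI)
    fix z' \<rho>s vs \<Delta>\<rho> \<Delta>v
    assume z': "z' \<in> ball z d" and \<Delta>: "\<Delta>\<rho> < d" "0 < \<Delta>v" "\<Delta>v < d"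
      and \<rho>s: "\<rho>s \<in> partitions \<rho>l \<rho>h \<Delta>\<rho>" and vs: "vs \<in> partitions 0 (2 * pi) \<Delta>v"
      and mem: "z' \<in> (\<Inter>\<rho>\<in>set \<rho>s. fattening (C * \<Delta>v\<^sup>2) (sp_toeplitz (polygon vs (?a \<rho>))))"
    obtain \<rho>' where \<rho>': "\<rho>' \<in> set \<rho>s" "\<bar>\<rho>' - \<rho>\<bar> \<le> \<Delta>\<rho>"
      using partition_point_near[OF \<rho>s \<rho>] by blast
    then have \<rho>'_mem: "\<rho>' \<in> {\<rho>l..\<rho>h}"
      using \<rho>s partition_subset[of \<rho>l \<rho>h \<rho>s] by (auto simp: partitions_def)
    have pcont: "continuous_on (sphere 0 1) (polygon vs (?a \<rho>'))"
      using vs by (intro continuous_on_polygon) (simp add: partitions_def)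
    obtain \<mu> where \<mu>: "\<mu> \<in> sp_toeplitz (polygon vs (?a \<rho>'))" "cmod (z' - \<mu>) \<le> C * \<Delta>v\<^sup>2"
      using mem \<rho>'(1) by (auto simp: fattening_def dist_norm norm_minus_commute)
    have "invertible_op (toeplitz (\<lambda>t. polygon vs (?a \<rho>') t - \<mu>))"
    proof (rule \<eta>(2))
      show "continuous_on (sphere 0 1) (\<lambda>t. polygon vs (?a \<rho>') t - \<mu>)"
        using pcont by (intro continuous_intros)
      fix t :: complex assume t: "t \<in> sphere 0 1"
      have "cmod (?a \<rho>' t - ?a \<rho> t) < \<eta> / 4"
        using d0(2)[OF \<rho> \<rho>'_mem _ t] \<rho>'(2) \<Delta>(1) d(3) by simp
      moreover have "cmod (polygon vs (?a \<rho>') t - ?a \<rho>' t) \<le> \<eta> / 4"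
        using err[OF \<rho>'_mem vs t] small[OF \<Delta>(2,3)] by simp
      moreover have "cmod (z - z') \<le> \<eta> / 4"
        using z' d(4) by (simp add: dist_norm)
      moreover have "cmod (z' - \<mu>) \<le> \<eta> / 4" using \<mu>(2) small[OF \<Delta>(2,3)] by simp
      ultimately have "cmod ((polygon vs (?a \<rho>') t - ?a \<rho>' t) + (?a \<rho>' t - ?a \<rho> t) + (z - z') + (z' - \<mu>))
          \<le> \<eta> / 4 + \<eta> / 4 + \<eta> / 4 + \<eta> / 4"
        by (intro norm_triangle_mono) auto
      then show "cmod (polygon vs (?a \<rho>') t - \<mu> - (?a \<rho> t - z)) \<le> \<eta>"
        by (simp add: algebra_simps)
    qed
    then show False using \<mu>(1) sp_toeplitz_iff[OF pcont] by blast
  qed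
qed

text \<open>The intersections stay in a fixed disc. What is left of it outside the \<open>\<epsilon>\<close>-neighbourhood of \<open>\<Lambda>\<close> is
  compact, and finitely many of the excluded neighbourhoods cover it.\<close>

lemma uniformly_in_fattening:
  assumes \<rho>l: "0 < \<rho>l" "\<rho>l \<le> \<rho>h" and C: "0 \<le> C"
    and err: "\<And>\<rho> vs \<Delta> t. \<rho> \<in> {\<rho>l..\<rho>h} \<Longrightarrow> vs \<in> partitions 0 (2 * pi) \<Delta> \<Longrightarrow> t \<in> sphere 0 1 \<Longrightarrow>
      cmod (polygon vs (dilate \<rho> (laurent r s b)) t - dilate \<rho> (laurent r s b) t) \<le> C * \<Delta>\<^sup>2"
    and \<Lambda>: "\<Lambda> = (\<Inter>\<rho>\<in>{\<rho>l..\<rho>h}. sp_toeplitz (dilate \<rho> (laurent r s b)))"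
    and \<epsilon>: "0 < \<epsilon>"
  obtains d where "0 < d" "\<And>\<rho>s vs \<Delta>\<rho> \<Delta>v. \<Delta>\<rho> < d \<Longrightarrow> 0 < \<Delta>v \<Longrightarrow> \<Delta>v < d \<Longrightarrow>
    \<rho>s \<in> partitions \<rho>l \<rho>h \<Delta>\<rho> \<Longrightarrow> vs \<in> partitions 0 (2 * pi) \<Delta>v \<Longrightarrow>
    (\<Inter>\<rho>\<in>set \<rho>s. fattening (C * \<Delta>v\<^sup>2) (sp_toeplitz (polygon vs (dilate \<rho> (laurent r s b)))))
      \<subseteq> fattening \<epsilon> \<Lambda>"
proof -
  define X where "X \<rho>s vs \<Delta>v = (\<Inter>\<rho>\<in>set \<rho>s. fattening (C * \<Delta>v\<^sup>2)
    (sp_toeplitz (polygon vs (dilate \<rho> (laurent r s b)))))" for \<rho>s vs \<Delta>v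
  define excl where "excl d z' \<longleftrightarrow> (\<forall>\<rho>s vs \<Delta>\<rho> \<Delta>v. \<Delta>\<rho> < d \<longrightarrow> 0 < \<Delta>v \<longrightarrow> \<Delta>v < d \<longrightarrow>
    \<rho>s \<in> partitions \<rho>l \<rho>h \<Delta>\<rho> \<longrightarrow> vs \<in> partitions 0 (2 * pi) \<Delta>v \<longrightarrow> z' \<notin> X \<rho>s vs \<Delta>v)" for d z'
  obtain M where M: "\<And>\<rho> t. \<rho> \<in> {\<rho>l..\<rho>h} \<Longrightarrow> t \<in> sphere 0 1 \<Longrightarrow> cmod (dilate \<rho> (laurent r s b) t) \<le> M"
    by (rule dilate_laurent_bounded[OF \<rho>l(1)]) (rule that)
  have bounded: "cmod z' \<le> M + 2 * C"
    if \<rho>s: "\<rho>s \<in> partitions \<rho>l \<rho>h \<Delta>\<rho>" and vs: "vs \<in> partitions 0 (2 * pi) \<Delta>v" and \<Delta>v: "0 < \<Delta>v" "\<Delta>v \<le> 1"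
      and mem: "z' \<in> X \<rho>s vs \<Delta>v" for z' \<rho>s vs \<Delta>\<rho> \<Delta>v
  proof -
    obtain \<rho> where \<rho>: "\<rho> \<in> set \<rho>s" using partition_point_near[OF \<rho>s, of \<rho>l] \<rho>l by auto
    then have \<rho>_mem: "\<rho> \<in> {\<rho>l..\<rho>h}"
      using \<rho>s partition_subset[of \<rho>l \<rho>h \<rho>s] by (auto simp: partitions_def)
    obtain \<mu> where \<mu>: "\<mu> \<in> sp_toeplitz (polygon vs (dilate \<rho> (laurent r s b)))" "cmod (z' - \<mu>) \<le> C * \<Delta>v\<^sup>2"
      using mem \<rho> by (auto simp: X_def fattening_def dist_norm norm_minus_commute)
    have "\<Delta>v\<^sup>2 \<le> 1" using \<Delta>v by (simp add: power_le_one)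
    then have C1: "C * \<Delta>v\<^sup>2 \<le> C" using C mult_left_mono[of "\<Delta>v\<^sup>2" 1 C] by simp
    have "cmod \<mu> \<le> M + C"
    proof (rule sp_toeplitz_bounded[OF _ _ \<mu>(1)])
      show "continuous_on (sphere 0 1) (polygon vs (dilate \<rho> (laurent r s b)))"
        using vs by (intro continuous_on_polygon) (simp add: partitions_def)
      show "cmod (polygon vs (dilate \<rho> (laurent r s b)) t) \<le> M + C" if "t \<in> sphere 0 1" for t
        using M[OF \<rho>_mem that] err[OF \<rho>_mem vs that] C1
          norm_triangle_sub[of "polygon vs (dilate \<rho> (laurent r s b)) t" "dilate \<rho> (laurent r s b) t"]
        by linarith
    qed
    then show ?thesis using \<mu>(2) C1 norm_triangle_sub[of z' \<mu>] by linarith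
  qed
  define K where "K = cball 0 (M + 2 * C) - (\<Union>x\<in>\<Lambda>. ball x \<epsilon>)"
  have K: "compact K" unfolding K_def by (intro compact_diff compact_cball open_UN) auto
  have "\<exists>d>0. \<forall>z'\<in>ball z d. excl d z'" if "z \<in> K" for z
  proof -
    have "z \<notin> \<Lambda>" using that \<epsilon> by (auto simp: K_def)
    then obtain \<rho> where \<rho>: "\<rho> \<in> {\<rho>l..\<rho>h}" "z \<notin> sp_toeplitz (dilate \<rho> (laurent r s b))"
      unfolding \<Lambda> by blast
    show ?thesis
    proof (rule locally_excluded[OF \<rho>l(1) \<rho>(1) C err \<rho>(2)])
      fix d assume d: "0 < d" "\<And>z' \<rho>s vs \<Delta>\<rho> \<Delta>v. z' \<in> ball z d \<Longrightarrow> \<Delta>\<rho> < d \<Longrightarrow> 0 < \<Delta>v \<Longrightarrow> \<Delta>v < d \<Longrightarrow>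
          \<rho>s \<in> partitions \<rho>l \<rho>h \<Delta>\<rho> \<Longrightarrow> vs \<in> partitions 0 (2 * pi) \<Delta>v \<Longrightarrow>
          z' \<notin> (\<Inter>\<rho>\<in>set \<rho>s. fattening (C * \<Delta>v\<^sup>2) (sp_toeplitz (polygon vs (dilate \<rho> (laurent r s b)))))"
      have "excl d z'" if z': "z' \<in> ball z d" for z'
        unfolding excl_def X_def by (intro allI impI) (rule d(2)[OF z'])
      then show "\<exists>d>0. \<forall>z'\<in>ball z d. excl d z'" using d(1) by blast
    qed
  qed
  then obtain D where D: "\<And>z. z \<in> K \<Longrightarrow> 0 < D z" "\<And>z z'. z \<in> K \<Longrightarrow> z' \<in> ball z (D z) \<Longrightarrow> excl (D z) z'"
    by metis
  have "K \<subseteq> (\<Union>z\<in>K. ball z (D z))" using D(1) by force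
  then obtain K' where K': "K' \<subseteq> K" "finite K'" "K \<subseteq> (\<Union>z\<in>K'. ball z (D z))"
    using compactE_image[OF K, of K "\<lambda>z. ball z (D z)"] by auto
  define d where "d = Min (insert 1 (D ` K'))"
  have d: "0 < d" "d \<le> 1" "\<And>z. z \<in> K' \<Longrightarrow> d \<le> D z"
    using K' D(1) by (auto simp: d_def)
  show thesis
  proof (rule that[OF d(1)], rule subsetI)
    fix \<rho>s vs \<Delta>\<rho> \<Delta>v z'
    assume *: "\<Delta>\<rho> < d" "0 < \<Delta>v" "\<Delta>v < d" "\<rho>s \<in> partitions \<rho>l \<rho>h \<Delta>\<rho>" "vs \<in> partitions 0 (2 * pi) \<Delta>v"
      and "z' \<in> (\<Inter>\<rho>\<in>set \<rho>s. fattening (C * \<Delta>v\<^sup>2) (sp_toeplitz (polygon vs (dilate \<rho> (laurent r s b)))))"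
    then have mem: "z' \<in> X \<rho>s vs \<Delta>v" by (simp add: X_def)
    have "z' \<notin> K"
    proof
      assume "z' \<in> K"
      then obtain z where "z \<in> K'" "z' \<in> ball z (D z)" using K'(3) by blast
      then have "excl (D z) z'" "d \<le> D z" using D(2) K'(1) d(3) by blast+
      then show False using * mem unfolding excl_def by (meson order.strict_trans2)
    qed
    moreover have "cmod z' \<le> M + 2 * C"
      using bounded[OF *(4,5) *(2) _ mem] *(3) d(2) by simp
    ultimately show "z' \<in> fattening \<epsilon> \<Lambda>"
      by (auto simp: K_def fattening_def intro: less_imp_le)
  qed
qed

theorem corollary2p10:
  fixes r s :: nat and b :: "int \<Rightarrow> complex" and \<rho>l \<rho>h :: real
  assumes "r > 0" and "s > 0"
    and "b (- int r) \<noteq> 0" and "b (int s) \<noteq> 0"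
    and "0 < \<rho>l" and "\<rho>l \<le> \<rho>h"
    and "limit_set r s b = (\<Inter>\<rho>\<in>{\<rho>l..\<rho>h}. sp_toeplitz (dilate \<rho> (laurent r s b)))"
  shows "\<exists>C :: real \<Rightarrow> real. (\<forall>\<rho>\<in>{\<rho>l..\<rho>h}. 0 \<le> C \<rho>) \<and>
    (\<forall>\<rho>s \<Delta>v vs. is_partition \<rho>l \<rho>h \<rho>s \<longrightarrow> 0 < \<Delta>v \<longrightarrow> vs \<in> partitions 0 (2 * pi) \<Delta>v \<longrightarrow>
       limit_set r s b \<subseteq>
         (\<Inter>\<rho>\<in>set \<rho>s. fattening (C \<rho> * \<Delta>v\<^sup>2)
            (sp_toeplitz (polygon vs (dilate \<rho> (laurent r s b)))))) \<and>
    ((\<lambda>(\<Delta>\<rho>, \<Delta>v).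
        SUP (\<rho>s, vs) \<in> partitions \<rho>l \<rho>h \<Delta>\<rho> \<times> partitions 0 (2 * pi) \<Delta>v.
          hausdorff_dist
            (\<Inter>\<rho>\<in>set \<rho>s. fattening (C \<rho> * \<Delta>v\<^sup>2)
               (sp_toeplitz (polygon vs (dilate \<rho> (laurent r s b)))))
            (limit_set r s b))
      \<longlongrightarrow> 0) (at_right 0 \<times>\<^sub>F at_right 0)"
proof -
  let ?\<Lambda> = "limit_set r s b"
  obtain L where L: "0 \<le> L" "\<And>\<rho>. \<rho> \<in> {\<rho>l..\<rho>h} \<Longrightarrow> curvature_bound r s b \<rho> \<le> L"
    by (rule curvature_bound_bounded[OF assms(5)]) (rule that)
  \<comment> \<open>One constant serves all radii, the curvature being bounded on the compact range.\<close>
  define C where "C = 2 * L"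
  have C: "0 \<le> C" using L by (simp add: C_def)
  have err: "cmod (polygon vs (dilate \<rho> (laurent r s b)) t - dilate \<rho> (laurent r s b) t) \<le> C * \<Delta>\<^sup>2"
    if "\<rho> \<in> {\<rho>l..\<rho>h}" "vs \<in> partitions 0 (2 * pi) \<Delta>" "t \<in> sphere 0 1" for \<rho> vs \<Delta> t
  proof -
    have "cmod (polygon vs (dilate \<rho> (laurent r s b)) t - dilate \<rho> (laurent r s b) t)
        \<le> 2 * curvature_bound r s b \<rho> * \<Delta>\<^sup>2"
      using that assms(5) by (intro polygon_error_laurent) auto
    also have "\<dots> \<le> C * \<Delta>\<^sup>2" unfolding C_def using L(2)[OF that(1)] by (intro mult_right_mono) auto
    finally show ?thesis .
  qed
  have lower: "?\<Lambda> \<subseteq> (\<Inter>\<rho>\<in>set \<rho>s. fattening (C * \<Delta>v\<^sup>2) (sp_toeplitz (polygon vs (dilate \<rho> (laurent r s b)))))"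
    if \<rho>s: "is_partition \<rho>l \<rho>h \<rho>s" and vs: "vs \<in> partitions 0 (2 * pi) \<Delta>v" for \<rho>s vs \<Delta>v
  proof (rule INT_greatest)
    fix \<rho> assume "\<rho> \<in> set \<rho>s"
    then have \<rho>: "\<rho> \<in> {\<rho>l..\<rho>h}" using partition_subset[OF \<rho>s] by blast
    then have "?\<Lambda> \<subseteq> sp_toeplitz (dilate \<rho> (laurent r s b))" unfolding assms(7) by blast
    also have "\<dots> \<subseteq> fattening (C * \<Delta>v\<^sup>2) (sp_toeplitz (polygon vs (dilate \<rho> (laurent r s b))))"
    proof (rule sp_toeplitz_subset_fattening)
      show "continuous_on (sphere 0 1) (dilate \<rho> (laurent r s b))"
        using \<rho> assms(5) by (intro continuous_on_dilate_laurent) simp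
      show "continuous_on (sphere 0 1) (polygon vs (dilate \<rho> (laurent r s b)))"
        using vs by (intro continuous_on_polygon) (simp add: partitions_def)
    qed (use C err[OF \<rho> vs] in auto)
    finally show "?\<Lambda> \<subseteq> fattening (C * \<Delta>v\<^sup>2) (sp_toeplitz (polygon vs (dilate \<rho> (laurent r s b))))" .
  qed
  define G where "G \<Delta>\<rho> \<Delta>v = (SUP (\<rho>s, vs) \<in> partitions \<rho>l \<rho>h \<Delta>\<rho> \<times> partitions 0 (2 * pi) \<Delta>v.
      hausdorff_dist
        (\<Inter>\<rho>\<in>set \<rho>s. fattening (C * \<Delta>v\<^sup>2) (sp_toeplitz (polygon vs (dilate \<rho> (laurent r s b))))) ?\<Lambda>)"
    for \<Delta>\<rho> \<Delta>v
  have pos: "eventually (\<lambda>x::real. 0 < x \<and> x < d) (at_right 0)" if "0 < d" for d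
    using that eventually_at_right_field by (auto simp: eventually_at_right_field)
  have "((\<lambda>(\<Delta>\<rho>, \<Delta>v). G \<Delta>\<rho> \<Delta>v) \<longlongrightarrow> 0) (at_right 0 \<times>\<^sub>F at_right 0)"
  proof (rule order_tendstoI)
    fix a :: ereal assume a: "a < 0"
    \<comment> \<open>The supremum of the empty set is \<open>-\<infinity>\<close>, so partitions of every granularity have to exist.\<close>
    have "0 \<le> G \<Delta>\<rho> \<Delta>v" if \<Delta>: "0 < \<Delta>\<rho>" "0 < \<Delta>v" for \<Delta>\<rho> \<Delta>v
    proof -
      obtain \<rho>s vs where "\<rho>s \<in> partitions \<rho>l \<rho>h \<Delta>\<rho>" "vs \<in> partitions 0 (2 * pi) \<Delta>v"
        using partitions_nonempty[OF assms(6) \<Delta>(1)] partitions_nonempty[OF _ \<Delta>(2), of 0 "2 * pi"]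
        by auto
      then show ?thesis
        unfolding G_def by (intro SUP_upper2[of "(\<rho>s, vs)"]) (auto simp: hausdorff_dist_nonneg)
    qed
    then have "a < G \<Delta>\<rho> \<Delta>v" if "0 < \<Delta>\<rho>" "0 < \<Delta>v" for \<Delta>\<rho> \<Delta>v
      using that a by (meson order.strict_trans2)
    then show "eventually (\<lambda>x. a < (case x of (\<Delta>\<rho>, \<Delta>v) \<Rightarrow> G \<Delta>\<rho> \<Delta>v)) (at_right 0 \<times>\<^sub>F at_right 0)"
      using eventually_prodI[OF pos[of 1] pos[of 1]] by (auto elim!: eventually_mono)
  next
    fix a :: ereal assume "0 < a"
    then obtain \<epsilon> where \<epsilon>: "0 < \<epsilon>" "ereal \<epsilon> < a"
      using ereal_dense2[of 0 a] by auto
    obtain d where d: "0 < d" "\<And>\<rho>s vs \<Delta>\<rho> \<Delta>v. \<Delta>\<rho> < d \<Longrightarrow> 0 < \<Delta>v \<Longrightarrow> \<Delta>v < d \<Longrightarrow>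
        \<rho>s \<in> partitions \<rho>l \<rho>h \<Delta>\<rho> \<Longrightarrow> vs \<in> partitions 0 (2 * pi) \<Delta>v \<Longrightarrow>
        (\<Inter>\<rho>\<in>set \<rho>s. fattening (C * \<Delta>v\<^sup>2) (sp_toeplitz (polygon vs (dilate \<rho> (laurent r s b)))))
          \<subseteq> fattening \<epsilon> ?\<Lambda>"
      by (rule uniformly_in_fattening[OF assms(5,6) C err assms(7) \<epsilon>(1)]) (assumption+, rule that)
    have "G \<Delta>\<rho> \<Delta>v \<le> ereal \<epsilon>" if "\<Delta>\<rho> < d" "0 < \<Delta>v" "\<Delta>v < d" for \<Delta>\<rho> \<Delta>v
      unfolding G_def
    proof (rule SUP_least, clarify)
      fix \<rho>s vs assume *: "\<rho>s \<in> partitions \<rho>l \<rho>h \<Delta>\<rho>" "vs \<in> partitions 0 (2 * pi) \<Delta>v"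
      show "hausdorff_dist (\<Inter>\<rho>\<in>set \<rho>s. fattening (C * \<Delta>v\<^sup>2)
          (sp_toeplitz (polygon vs (dilate \<rho> (laurent r s b))))) ?\<Lambda> \<le> ereal \<epsilon>"
        by (intro hausdorff_dist_le_if_superset lower d(2)[OF that *])
          (use \<epsilon> * in \<open>auto simp: partitions_def\<close>)
    qed
    then have "G \<Delta>\<rho> \<Delta>v < a" if "\<Delta>\<rho> < d" "0 < \<Delta>v" "\<Delta>v < d" for \<Delta>\<rho> \<Delta>v
      using that \<epsilon>(2) by (meson order.strict_trans1)
    then show "eventually (\<lambda>x. (case x of (\<Delta>\<rho>, \<Delta>v) \<Rightarrow> G \<Delta>\<rho> \<Delta>v) < a) (at_right 0 \<times>\<^sub>F at_right 0)"
      using eventually_prodI[OF pos[OF d(1)] pos[OF d(1)]] by (auto elim!: eventually_mono)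
  qed
  then show ?thesis
    using C lower unfolding G_def by (intro exI[of _ "\<lambda>_. C"]) blast
qed

end
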